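(* Let $t=t(n)\in\mathbb N$ with $t<n$, let $F=F(n,t)$ be chosen uniformly at random from $\mathcal F(n,t)$, and let $\varepsilon>0$. Then (1) with high probability $\Delta(F)\le\lfloor\mu(n)\rfloor+2$; (2) if $t=O(n^{1-\beta})$ for some fixed $\beta>0$, then with high probability $\lfloor\mu(n)-\varepsilon\rfloor+1\le\Delta(F)\le\lfloor\mu(n)+\varepsilon\rfloor+1$, and $\Delta(F)-\max\{d_F(r):r\in[t]\}=\omega(1)$ with high probability (i.e. for every constant $K$, with probability tending to $1$ this difference is at least $K$).
   Context: $\mathcal F(n,t)$ is the class of forests on vertex set $[n]$ with exactly $t$ tree components (isolated vertices allowed) such that the vertices $1,\dots,t$ lie in pairwise different components. $d_F(v)$ is the degree of $v$, $\Delta(F)$ the maximum degree. "With high probability" means with probability tending to $1$ as $n\to\infty$. $\mu(n)$ is the unique positive zero of $y\mapsto y-(y+1/2)\log y+\log n$ ($\log$ natural). *)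

theory Defs
  imports "HOL-Probability.Probability" "HOL-Library.Landau_Symbols"
begin

section \<open>Finite simple graphs\<close>

text \<open>
  A simple graph on a given vertex set \<open>V\<close> is identified with its set of edges,
  an edge being a two-element subset of \<open>V\<close>. (Predicates for forests of digraphs are of no
  use here: in a symmetric digraph every edge gives a directed cycle of length two.)
\<close>

definition simple_graph :: "'a set \<Rightarrow> 'a set set \<Rightarrow> bool" where
  "simple_graph V E \<longleftrightarrow> (\<forall>e\<in>E. e \<subseteq> V \<and> card e = 2)"

definition adjacent :: "'a set set \<Rightarrow> 'a \<Rightarrow> 'a \<Rightarrow> bool" where
  "adjacent E u v \<longleftrightarrow> {u, v} \<in> E"

definition graph_component :: "'a set \<Rightarrow> 'a set set \<Rightarrow> 'a \<Rightarrow> 'a set" where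
  "graph_component V E v = {u \<in> V. (adjacent E)\<^sup>*\<^sup>* v u}"

definition graph_components :: "'a set \<Rightarrow> 'a set set \<Rightarrow> 'a set set" where
  "graph_components V E = graph_component V E ` V"

definition is_cycle :: "'a set set \<Rightarrow> 'a list \<Rightarrow> bool" where
  "is_cycle E vs \<longleftrightarrow> length vs \<ge> 3 \<and> distinct vs \<and>
     (\<forall>i<length vs. adjacent E (vs ! i) (vs ! (Suc i mod length vs)))"

definition is_forest :: "'a set \<Rightarrow> 'a set set \<Rightarrow> bool" where
  "is_forest V E \<longleftrightarrow> simple_graph V E \<and> (\<nexists>vs. is_cycle E vs)"

definition vertex_degree :: "'a set set \<Rightarrow> 'a \<Rightarrow> nat" where
  "vertex_degree E v = card {e \<in> E. v \<in> e}"

definition max_degree :: "'a set \<Rightarrow> 'a set set \<Rightarrow> nat" where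
  "max_degree V E = Max (vertex_degree E ` V)"

section \<open>Random forests\<close>

definition forests :: "nat \<Rightarrow> nat \<Rightarrow> nat set set set" where
  "forests n t = {F. is_forest {1..n} F \<and> card (graph_components {1..n} F) = t \<and>
     (\<forall>i\<in>{1..t}. \<forall>j\<in>{1..t}. i \<noteq> j \<longrightarrow> graph_component {1..n} F i \<noteq> graph_component {1..n} F j)}"

definition random_forest :: "nat \<Rightarrow> nat \<Rightarrow> nat set set pmf" where
  "random_forest n t = pmf_of_set (forests n t)"

definition with_high_probability :: "(nat \<Rightarrow> 'a pmf) \<Rightarrow> (nat \<Rightarrow> 'a \<Rightarrow> bool) \<Rightarrow> bool" where
  "with_high_probability p P \<longleftrightarrow>
     (\<lambda>n. measure_pmf.prob (p n) {x. P n x}) \<longlonglongrightarrow> 1"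

definition mu :: "nat \<Rightarrow> real" where
  "mu n = (THE y. y > 0 \<and> y - (y + 1/2) * ln y + ln (real n) = 0)"

section \<open>Well-definedness\<close>

lemma finite_forests: "finite (forests n t)"
proof (rule finite_subset)
  show "forests n t \<subseteq> Pow (Pow {1..n})"
    by (auto simp: forests_def is_forest_def simple_graph_def)
qed simp

lemma forests_nonempty:
  assumes "1 \<le> t" "t \<le> n"
  shows "forests n t \<noteq> {}"
proof -
  define F where "F = (\<lambda>v. {1, v}) ` {t<..n}"
  define S where "S = insert 1 {t<..n}"
  have adj: "adjacent F u v \<longleftrightarrow> (u = 1 \<and> v \<in> {t<..n}) \<or> (v = 1 \<and> u \<in> {t<..n})" for u v
    unfolding adjacent_def F_def image_iff doubleton_eq_iff by blast
  have "\<not> is_cycle F vs" for vs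
  proof
    assume c: "is_cycle F vs"
    let ?l = "length vs"
    have l: "?l \<ge> 3" and d: "distinct vs"
      and a: "\<And>i. i < ?l \<Longrightarrow> adjacent F (vs ! i) (vs ! (Suc i mod ?l))"
      using c by (auto simp: is_cycle_def)
    have a': "adjacent F (vs ! i) (vs ! Suc i)" if "Suc i < ?l" for i
      using a[of i] that by simp
    have a0: "adjacent F (vs ! 0) (vs ! 1)" using a'[of 0] l by simp
    have a1: "adjacent F (vs ! 1) (vs ! 2)" using a'[of 1] l by (simp add: numeral_2_eq_2)
    have "2 < ?l" using l by simp
    from a[OF this] have a2: "adjacent F (vs ! 2) (vs ! (3 mod ?l))"
      by (simp only: eval_nat_numeral)
    have "3 mod ?l \<noteq> 1" using l by (cases "?l = 3") auto
    moreover have "3 mod ?l < ?l" using l by (intro mod_less_divisor) linarith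
    ultimately have n13: "vs ! (3 mod ?l) \<noteq> vs ! 1"
      using nth_eq_iff_index_eq[OF d, of "3 mod ?l" 1] l by linarith
    have n02: "vs ! 0 \<noteq> vs ! 2"
      using nth_eq_iff_index_eq[OF d, of 0 2] l by linarith
    show False using a0 a1 a2 n13 n02 assms by (auto simp: adj)
  qed
  moreover have "simple_graph {1..n} F"
    using assms by (auto simp: simple_graph_def F_def card_insert_if)
  ultimately have forest: "is_forest {1..n} F"
    by (simp add: is_forest_def)
  have stay: "(adjacent F)\<^sup>*\<^sup>* u v \<Longrightarrow> v = u \<or> (u \<in> S \<and> v \<in> S)" for u v
    by (induction rule: rtranclp_induct) (auto simp: adj S_def)
  have from1: "(adjacent F)\<^sup>*\<^sup>* 1 v" and to1: "(adjacent F)\<^sup>*\<^sup>* v 1" if "v \<in> S" for v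
    using that by (cases "v = 1"; force simp: S_def adj)+
  have comp_S: "graph_component {1..n} F v = S" if "v \<in> S" for v
  proof -
    have "S \<subseteq> {1..n}" using assms by (auto simp: S_def)
    then show ?thesis
      using stay[of v] that rtranclp_trans[OF to1[OF that] from1]
      by (auto simp: graph_component_def)
  qed
  have comp_out: "graph_component {1..n} F v = {v}" if "v \<in> {1..n} - S" for v
    using that stay[of v] unfolding graph_component_def by blast
  have V: "{1..n} = S \<union> {2..t}" and out: "{2..t} \<subseteq> {1..n} - S"
    using assms by (auto simp: S_def)
  have "graph_component {1..n} F ` {2..t} = (\<lambda>v. {v}) ` {2..t}"
    by (rule image_cong[OF refl]) (use out comp_out in blast)
  moreover have "graph_component {1..n} F ` S = {S}"
    using comp_S by (auto simp: S_def)
  ultimately have "graph_components {1..n} F = insert S ((\<lambda>v. {v}) ` {2..t})"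
    unfolding graph_components_def by (subst (2) V) (simp only: image_Un, simp)
  moreover have "S \<notin> (\<lambda>v. {v}) ` {2..t}"
    by (auto simp: S_def)
  ultimately have "card (graph_components {1..n} F) = t"
    using assms by (simp add: card_image)
  moreover have "graph_component {1..n} F i \<noteq> graph_component {1..n} F j"
    if "i \<in> {1..t}" "j \<in> {1..t}" "i \<noteq> j" for i j
  proof -
    have *: "graph_component {1..n} F k \<inter> {1..t} = {k}" if k: "k \<in> {1..t}" for k
    proof (cases "k = 1")
      case True
      then have "graph_component {1..n} F k = S" by (intro comp_S) (simp add: S_def)
      then show ?thesis using True assms by (auto simp: S_def)
    next
      case False
      then have "k \<in> {2..t}" using k by auto
      then have "graph_component {1..n} F k = {k}" using comp_out out by blast
      then show ?thesis using k by auto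
    qed
    show ?thesis using *[OF that(1)] *[OF that(2)] that(3) by auto
  qed
  ultimately have "F \<in> forests n t"
    using forest by (simp add: forests_def)
  then show ?thesis by blast
qed

lemma mu_ex1:
  assumes "n \<ge> 1"
  shows "\<exists>!y::real. y > 0 \<and> y - (y + 1/2) * ln y + ln (real n) = 0"
proof -
  define f where "f = (\<lambda>y::real. y - (y + 1/2) * ln y + ln (real n))"
  have deriv: "(f has_real_derivative (- ln y - 1 / (2 * y))) (at y)" if "y > 0" for y
    unfolding f_def using that
    by (auto intro!: derivative_eq_intros simp: field_simps)
  have neg: "- ln y - 1 / (2 * y) < 0" if y: "y > 0" for y :: real
  proof -
    have "ln (1 / (2 * y)) \<le> 1 / (2 * y) - 1" using y by (intro ln_le_minus_one) auto
    moreover have "ln (1 / (2 * y)) = - ln 2 - ln y" using y by (simp add: ln_div ln_mult)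
    moreover have "ln (2::real) < 1" using ln_2_less_1 .
    ultimately show ?thesis by linarith
  qed
  have less: "f b < f a" if "0 < a" "a < b" for a b
  proof (rule DERIV_neg_imp_decreasing[OF \<open>a < b\<close>])
    fix x assume "a \<le> x"
    then have "x > 0" using \<open>0 < a\<close> by simp
    then show "\<exists>y. (f has_real_derivative y) (at x) \<and> y < 0"
      using deriv[of x] neg[of x] by blast
  qed
  have "f 1 > 0" using assms by (simp add: f_def add_pos_nonneg)
  define b where "b = exp (2 + ln (real n))"
  have lnn: "ln (real n) \<ge> 0" using assms by simp
  have "b \<ge> 1" unfolding b_def using lnn by simp
  have "f b = - b - b * ln (real n) - 1 - ln (real n) / 2 + ln (real n)"
    by (simp add: f_def b_def field_simps)
  moreover have "b * ln (real n) \<ge> 1 * ln (real n)"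
    using \<open>b \<ge> 1\<close> lnn by (rule mult_right_mono)
  ultimately have "f b \<le> 0" using \<open>b \<ge> 1\<close> lnn by linarith
  have "isCont f x" if "x \<ge> 1" for x
    by (rule DERIV_isCont[OF deriv]) (use that in simp)
  then have "\<exists>x\<ge>1. x \<le> b \<and> f x = 0"
    by (intro IVT2) (use \<open>f 1 > 0\<close> \<open>f b \<le> 0\<close> \<open>b \<ge> 1\<close> in auto)
  then obtain x where "x \<ge> 1" "f x = 0" by blast
  then have x: "x > 0" "f x = 0" by auto
  have "y = x" if "y > 0" "f y = 0" for y
    using less[of x y] less[of y x] that x by linarith
  then have "\<exists>!y. y > 0 \<and> f y = 0" using x by blast
  then show ?thesis by (simp add: f_def)
qed

end

theory Submission
  imports Defs "HOL-Real_Asymp.Real_Asymp"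
begin

text \<open>
  A Pruefer-type code turns a uniform forest of \<open>\<F>(n,t)\<close> into a uniform word of length \<open>n - t\<close>
  over \<open>[n]\<close> whose last letter lies in \<open>[t]\<close>; the degree of a vertex is its number of occurrences,
  plus one if it is not a root. So the maximum degree is, up to the last letter, one plus the
  maximum load of \<open>n - t - 1\<close> balls thrown into \<open>n\<close> bins. By Stirling, \<open>n / k!\<close> tends to \<open>0\<close> if
  \<open>k \<ge> \<mu>(n) + \<epsilon>\<close>, which gives the upper bounds by a union bound, and to infinity if
  \<open>k \<le> \<mu>(n) - \<epsilon>\<close>, which gives the lower bound by the second moment method. As there are only
  \<open>O(n\<^bsup>1-\<beta>\<^esup>)\<close> roots, the union bound over the roots still tends to \<open>0\<close> for \<open>k = \<mu>(n) - O(1)\<close>.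
\<close>

section \<open>Rooted forests\<close>

text \<open>No bijection between forests and words is constructed. For each prescribed degree
  function both are counted, and the counts obey the same recursion, obtained by removing a non-root
  of degree one; equality of the joint degree statistics is all that the probabilities need. Only
  implications from degrees to letter counts are used, so the last letter, which is not uniform on
  \<open>[n]\<close>, is split off and its \<open>t\<close> choices cancel. The equation for
  \<open>mu n\<close> says that \<open>ln (fact y)\<close>, in Stirling's approximation without its
  constant, equals \<open>ln n\<close> at \<open>y = mu n\<close>. Moving \<open>y\<close> by
  \<delta> changes \<open>n / y!\<close> by a factor of about \<open>mu n\<close> to the power
  \<delta>, which is unbounded because \<open>mu n\<close> tends to infinity. So every fixed shift
  suffices and a bounded error in Stirling's formula is harmless. The second moment method counts
  non-roots occurring exactly \<open>k\<close> times: exact counts have closed binomial moments, the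
  degree of a non-root is exactly one more than its count, and for \<open>t = o(n)\<close> almost
  all vertices are non-roots.\<close>

lemma adjacent_commute: "adjacent E u v \<longleftrightarrow> adjacent E v u"
  by (simp add: adjacent_def insert_commute)

lemma adjacent_rtranclp_sym: "(adjacent E)\<^sup>*\<^sup>* u v \<Longrightarrow> (adjacent E)\<^sup>*\<^sup>* v u"
  by (induction rule: rtranclp_induct)
     (auto intro: converse_rtranclp_into_rtranclp adjacent_commute[THEN iffD1])

text \<open>Roots replace the component count and the vertex set is arbitrary: this form is
  inherited when a non-root leaf is removed, as the recursion requires.\<close>

definition rooted_forests :: "'a set \<Rightarrow> 'a set \<Rightarrow> 'a set set set" where
  "rooted_forests V R = {E. is_forest V E \<and> (\<forall>v\<in>V. \<exists>r\<in>R. (adjacent E)\<^sup>*\<^sup>* r v) \<and>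
     (\<forall>r\<in>R. \<forall>s\<in>R. (adjacent E)\<^sup>*\<^sup>* r s \<longrightarrow> r = s)}"

lemma finite_rooted_forests: "finite V \<Longrightarrow> finite (rooted_forests V R)"
  by (rule finite_subset[of _ "Pow (Pow V)"])
     (auto simp: rooted_forests_def is_forest_def simple_graph_def)

lemma graph_component_eq_iff:
  assumes "u \<in> V" "v \<in> V"
  shows "graph_component V E u = graph_component V E v \<longleftrightarrow> (adjacent E)\<^sup>*\<^sup>* u v"
proof
  assume "graph_component V E u = graph_component V E v"
  then show "(adjacent E)\<^sup>*\<^sup>* u v" using assms by (auto simp: graph_component_def)
next
  assume "(adjacent E)\<^sup>*\<^sup>* u v"
  then show "graph_component V E u = graph_component V E v"
    by (auto simp: graph_component_def intro: rtranclp_trans dest: adjacent_rtranclp_sym)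
qed

text \<open>The \<open>t\<close> roots have distinct components, so having \<open>t\<close>
  components in all means, by finiteness, that every component is that of a root.\<close>

lemma forests_eq_rooted_forests:
  assumes "t \<le> n"
  shows "forests n t = rooted_forests {1..n} {1..t}"
proof -
  have "(card (graph_components {1..n} F) = t \<and>
     (\<forall>i\<in>{1..t}. \<forall>j\<in>{1..t}. i \<noteq> j \<longrightarrow> graph_component {1..n} F i \<noteq> graph_component {1..n} F j))
    \<longleftrightarrow> (\<forall>v\<in>{1..n}. \<exists>r\<in>{1..t}. (adjacent F)\<^sup>*\<^sup>* r v) \<and>
        (\<forall>r\<in>{1..t}. \<forall>s\<in>{1..t}. (adjacent F)\<^sup>*\<^sup>* r s \<longrightarrow> r = s)" (is "?L \<longleftrightarrow> ?R") for F
  proof -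
    let ?c = "graph_component {1..n} F"
    have sub: "{1..t} \<subseteq> {1..n}" using assms by auto
    have eq: "?c i = ?c j \<longleftrightarrow> (adjacent F)\<^sup>*\<^sup>* i j" if "i \<in> {1..n}" "j \<in> {1..n}" for i j
      using that by (rule graph_component_eq_iff)
    have inj: "(\<forall>r\<in>{1..t}. \<forall>s\<in>{1..t}. (adjacent F)\<^sup>*\<^sup>* r s \<longrightarrow> r = s) \<longleftrightarrow> inj_on ?c {1..t}"
      unfolding inj_on_def using eq sub by blast
    have inj': "(\<forall>i\<in>{1..t}. \<forall>j\<in>{1..t}. i \<noteq> j \<longrightarrow> ?c i \<noteq> ?c j) \<longleftrightarrow> inj_on ?c {1..t}"
      unfolding inj_on_def by blast
    have surj: "(\<forall>v\<in>{1..n}. \<exists>r\<in>{1..t}. (adjacent F)\<^sup>*\<^sup>* r v) \<longleftrightarrow> ?c ` {1..n} \<subseteq> ?c ` {1..t}"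
    proof -
      have "(\<exists>r\<in>{1..t}. (adjacent F)\<^sup>*\<^sup>* r v) \<longleftrightarrow> ?c v \<in> ?c ` {1..t}" if "v \<in> {1..n}" for v
      proof -
        have "?c v = ?c r \<longleftrightarrow> (adjacent F)\<^sup>*\<^sup>* r v" if "r \<in> {1..t}" for r
          using eq[of r v] sub that \<open>v \<in> {1..n}\<close> by auto
        then show ?thesis by blast
      qed
      then show ?thesis by blast
    qed
    have "card (?c ` {1..n}) = t \<longleftrightarrow> ?c ` {1..n} \<subseteq> ?c ` {1..t}" if "inj_on ?c {1..t}"
    proof -
      have c: "card (?c ` {1..t}) = t" using card_image[OF that] by simp
      have s: "?c ` {1..t} \<subseteq> ?c ` {1..n}" using sub by blast
      show ?thesis
        using c s card_subset_eq[of "?c ` {1..n}" "?c ` {1..t}"]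
        by (metis finite_atLeastAtMost finite_imageI order_refl subset_antisym)
    qed
    then show ?thesis
      unfolding inj inj' surj graph_components_def by blast
  qed
  then show ?thesis
    unfolding forests_def rooted_forests_def by blast
qed

lemma rooted_forests_all_roots: "rooted_forests R R = {{}}"
proof -
  have "E = {}" if "E \<in> rooted_forests R R" for E
  proof (rule ccontr)
    assume "E \<noteq> {}"
    then obtain e where e: "e \<in> E" by blast
    then have "e \<subseteq> R" "card e = 2"
      using that by (auto simp: rooted_forests_def is_forest_def simple_graph_def)
    then obtain u v where uv: "e = {u, v}" "u \<noteq> v" by (meson card_2_iff)
    then have "adjacent E u v" using e by (simp add: adjacent_def)
    then show False using that uv \<open>e \<subseteq> R\<close> by (auto simp: rooted_forests_def)
  qed
  moreover have "(adjacent {})\<^sup>*\<^sup>* r s \<Longrightarrow> r = s" for r s :: 'a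
    by (induction rule: rtranclp_induct) (auto simp: adjacent_def)
  then have "{} \<in> rooted_forests R R"
    by (fastforce simp: rooted_forests_def is_forest_def simple_graph_def is_cycle_def adjacent_def)
  ultimately show ?thesis by blast
qed

section \<open>Attaching a leaf to a rooted forest\<close>

lemma reach_insert_leaf_iff:
  assumes "\<And>e. e \<in> E \<Longrightarrow> v \<notin> e" "a \<noteq> v" "b \<noteq> v" "w \<noteq> v"
  shows "(adjacent (insert {v, w} E))\<^sup>*\<^sup>* a b \<longleftrightarrow> (adjacent E)\<^sup>*\<^sup>* a b"
proof
  have adj: "adjacent (insert {v, w} E) x y \<longleftrightarrow> x = v \<and> y = w \<or> x = w \<and> y = v \<or> adjacent E x y" for x y
    by (auto simp: adjacent_def doubleton_eq_iff)
  have nv: "\<not> adjacent E v x" "\<not> adjacent E x v" for x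
    using assms(1) by (auto simp: adjacent_def)
  assume "(adjacent (insert {v, w} E))\<^sup>*\<^sup>* a b"
  \<comment> \<open>A walk may step into the leaf \<open>v\<close> and back, so the invariant
    follows it with \<open>v\<close> replaced by its only neighbour \<open>w\<close>.\<close>
  then have "(adjacent E)\<^sup>*\<^sup>* a (if b = v then w else b)"
  proof (induction rule: rtranclp_induct)
    case base then show ?case using assms(2) by simp
  next
    case (step x y)
    from step.hyps(2) consider "x = v" "y = w" | "x = w" "y = v" | "adjacent E x y"
      unfolding adj by blast
    then show ?case
    proof cases
      case 3
      then have "x \<noteq> v" "y \<noteq> v" using nv by auto
      then show ?thesis using step.IH 3 by simp
    qed (use step.IH assms in auto)
  qed
  then show "(adjacent E)\<^sup>*\<^sup>* a b" using assms(3) by simp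
next
  assume "(adjacent E)\<^sup>*\<^sup>* a b"
  then show "(adjacent (insert {v, w} E))\<^sup>*\<^sup>* a b"
    by (rule rtranclp_mono[THEN predicate2D, rotated]) (auto simp: adjacent_def)
qed

lemma is_cycle_mono: "is_cycle E vs \<Longrightarrow> E \<subseteq> E' \<Longrightarrow> is_cycle E' vs"
  by (auto simp: is_cycle_def adjacent_def)

text \<open>A vertex on a cycle of length at least three has distinct neighbours before and after
  it, while \<open>v\<close> is adjacent to \<open>w\<close> only. So the cycle avoids
  \<open>v\<close>, and with it the new edge.\<close>

lemma is_cycle_insert_leafD:
  assumes "\<And>e. e \<in> E \<Longrightarrow> v \<notin> e" "w \<noteq> v" "is_cycle (insert {v, w} E) vs"
  shows "is_cycle E vs"
proof -
  let ?l = "length vs" and ?E = "insert {v, w} E"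
  have l: "?l \<ge> 3" and d: "distinct vs"
    and a: "\<And>i. i < ?l \<Longrightarrow> adjacent ?E (vs ! i) (vs ! (Suc i mod ?l))"
    using assms(3) by (auto simp: is_cycle_def)
  have w: "y = w" if "adjacent ?E v y" for y
    using that assms by (auto simp: adjacent_def doubleton_eq_iff)
  have "v \<notin> set vs"
  proof
    assume "v \<in> set vs"
    then obtain i where i: "i < ?l" "vs ! i = v" by (auto simp: in_set_conv_nth)
    \<comment> \<open>\<open>p\<close> and \<open>q\<close> are the cyclic predecessor and successor
      of position \<open>i\<close>.\<close>
    define p where "p = (if i = 0 then ?l - 1 else i - 1)"
    have p: "p < ?l" "Suc p mod ?l = i"
      using i(1) by (auto simp: p_def)
    define q where "q = Suc i mod ?l"
    have q: "q < ?l" using l by (auto simp: q_def intro!: mod_less_divisor)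
    have "p \<noteq> q"
      using l i(1) by (cases "Suc i = ?l") (auto simp: p_def q_def)
    then have "vs ! p \<noteq> vs ! q" using nth_eq_iff_index_eq[OF d p(1) q] by simp
    moreover have "vs ! p = w" using a[OF p(1)] w i p(2) by (simp add: adjacent_commute)
    moreover have "vs ! q = w" using a[OF i(1)] w i by (simp add: q_def)
    ultimately show False by simp
  qed
  have "adjacent E (vs ! i) (vs ! (Suc i mod ?l))" if "i < ?l" for i
  proof -
    have "vs ! i \<noteq> v" "vs ! (Suc i mod ?l) \<noteq> v"
      using \<open>v \<notin> set vs\<close> that nth_mem[of i vs] nth_mem[of "Suc i mod ?l" vs]
        mod_less_divisor[of ?l "Suc i"] by fastforce+
    then show ?thesis using a[OF that] by (auto simp: adjacent_def doubleton_eq_iff)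
  qed
  then show ?thesis using l d by (auto simp: is_cycle_def)
qed

text \<open>A pendant edge closes no cycle and creates no connection among the other vertices;
  \<open>v\<close> is reached from a root through \<open>w\<close> and, being no root, cannot
  violate the separation of roots.\<close>

lemma insert_leaf_rooted_forests_iff:
  assumes "v \<in> V" "v \<notin> R" "R \<subseteq> V" "w \<in> V" "w \<noteq> v" "\<And>e. e \<in> E \<Longrightarrow> v \<notin> e"
  shows "insert {v, w} E \<in> rooted_forests V R \<longleftrightarrow> E \<in> rooted_forests (V - {v}) R"
proof -
  let ?E = "insert {v, w} E"
  have reach: "(adjacent ?E)\<^sup>*\<^sup>* a b \<longleftrightarrow> (adjacent E)\<^sup>*\<^sup>* a b" if "a \<noteq> v" "b \<noteq> v" for a b
    using reach_insert_leaf_iff[of E v a b w] assms that by blast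
  have adj: "adjacent ?E w v" by (auto simp: adjacent_def)
  have "is_forest V ?E \<longleftrightarrow> is_forest (V - {v}) E"
  proof -
    have "simple_graph V ?E \<longleftrightarrow> simple_graph (V - {v}) E"
      using assms by (auto simp: simple_graph_def)
    moreover have "is_cycle ?E vs \<longleftrightarrow> is_cycle E vs" for vs
      using is_cycle_insert_leafD[of E v w vs] is_cycle_mono[of E vs ?E] assms by blast
    ultimately show ?thesis by (simp add: is_forest_def)
  qed
  moreover have "(\<forall>x\<in>V. \<exists>r\<in>R. (adjacent ?E)\<^sup>*\<^sup>* r x) \<longleftrightarrow>
      (\<forall>x\<in>V - {v}. \<exists>r\<in>R. (adjacent E)\<^sup>*\<^sup>* r x)" (is "?A \<longleftrightarrow> ?B")
  proof
    assume ?A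
    show ?B
    proof
      fix x assume "x \<in> V - {v}"
      with \<open>?A\<close> obtain r where "r \<in> R" "(adjacent ?E)\<^sup>*\<^sup>* r x" by blast
      with \<open>x \<in> V - {v}\<close> show "\<exists>r\<in>R. (adjacent E)\<^sup>*\<^sup>* r x"
        using reach[of r x] assms(2) by blast
    qed
  next
    assume B: ?B
    have 1: "\<exists>r\<in>R. (adjacent ?E)\<^sup>*\<^sup>* r x" if x: "x \<in> V - {v}" for x
    proof -
      obtain r where r: "r \<in> R" "(adjacent E)\<^sup>*\<^sup>* r x" using B x by blast
      then have "(adjacent ?E)\<^sup>*\<^sup>* r x" using reach[of r x] assms(2) x by blast
      with r show ?thesis by blast
    qed
    have "\<exists>r\<in>R. (adjacent ?E)\<^sup>*\<^sup>* r v"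
    proof -
      obtain r where "r \<in> R" "(adjacent ?E)\<^sup>*\<^sup>* r w" using 1[of w] assms(4,5) by blast
      then show ?thesis using adj by (meson rtranclp.rtrancl_into_rtrancl)
    qed
    with 1 show ?A by blast
  qed
  moreover have "(\<forall>r\<in>R. \<forall>s\<in>R. (adjacent ?E)\<^sup>*\<^sup>* r s \<longrightarrow> r = s) \<longleftrightarrow>
      (\<forall>r\<in>R. \<forall>s\<in>R. (adjacent E)\<^sup>*\<^sup>* r s \<longrightarrow> r = s)"
  proof -
    have "(adjacent ?E)\<^sup>*\<^sup>* r s \<longleftrightarrow> (adjacent E)\<^sup>*\<^sup>* r s" if "r \<in> R" "s \<in> R" for r s
      using reach[of r s] that assms(2) by blast
    then show ?thesis by blast
  qed
  ultimately show ?thesis by (simp add: rooted_forests_def)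
qed

lemma vertex_degree_insert:
  assumes "finite E" "e \<notin> E"
  shows "vertex_degree (insert e E) v = vertex_degree E v + (if v \<in> e then 1 else 0)"
proof -
  have "{f \<in> insert e E. v \<in> f} = (if v \<in> e then insert e {f \<in> E. v \<in> f} else {f \<in> E. v \<in> f})"
    by auto
  then show ?thesis using assms by (simp add: vertex_degree_def)
qed

section \<open>Existence of a non-root leaf\<close>

lemma exists_simple_path:
  "(adjacent E)\<^sup>*\<^sup>* r v \<Longrightarrow>
   \<exists>vs. vs \<noteq> [] \<and> hd vs = r \<and> last vs = v \<and> distinct vs \<and> successively (adjacent E) vs"
proof (induction rule: rtranclp_induct)
  case base
  then show ?case by (intro exI[of _ "[r]"]) auto
next
  case (step x y)
  then obtain vs where vs: "vs \<noteq> []" "hd vs = r" "last vs = x" "distinct vs"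
    "successively (adjacent E) vs" by blast
  show ?case
  proof (cases "y \<in> set vs")
    case False
    then show ?thesis using vs step.hyps(2)
      by (intro exI[of _ "vs @ [y]"]) (auto simp: successively_append_iff)
  next
    case True
    then obtain ys zs where yz: "vs = ys @ y # zs" by (meson split_list)
    then have "successively (adjacent E) (ys @ [y])" using vs(5)
      by (auto simp: successively_append_iff successively_Cons)
    then show ?thesis using vs yz
      by (intro exI[of _ "ys @ [y]"]) (auto simp: hd_append)
  qed
qed

lemma successively_chord_is_cycle:
  assumes "successively (adjacent E) (y # vs)" "distinct (y # vs)" "length vs \<ge> 2" "adjacent E (last vs) y"
  shows "is_cycle E (y # vs)"
  unfolding is_cycle_def
proof (intro conjI allI impI)
  let ?l = "length (y # vs)"
  fix i assume i: "i < ?l"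
  show "adjacent E ((y # vs) ! i) ((y # vs) ! (Suc i mod ?l))"
  proof (cases "Suc i = ?l")
    case True
    then show ?thesis using assms(3,4) by (auto simp: last_conv_nth nth_Cons')
  next
    case False
    then show ?thesis using assms(1) i
      by (auto simp: successively_conv_nth)
  qed
qed (use assms in auto)

text \<open>The far end of a longest path starting in a root is a leaf, and it is not a root.\<close>
lemma rooted_forests_leaf:
  assumes fin: "finite V" and "R \<subseteq> V" "R \<noteq> V" and E: "E \<in> rooted_forests V R"
  shows "\<exists>v\<in>V - R. vertex_degree E v = 1"
proof -
  have sg: "simple_graph V E" and nc: "\<And>vs. \<not> is_cycle E vs"
    and reach: "\<And>v. v \<in> V \<Longrightarrow> \<exists>r\<in>R. (adjacent E)\<^sup>*\<^sup>* r v"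
    and sep: "\<And>r s. r \<in> R \<Longrightarrow> s \<in> R \<Longrightarrow> (adjacent E)\<^sup>*\<^sup>* r s \<Longrightarrow> r = s"
    using E by (auto simp: rooted_forests_def is_forest_def)
  have adjV: "u \<in> V" "v \<in> V" "u \<noteq> v" if "adjacent E u v" for u v
    using sg that by (auto simp: simple_graph_def adjacent_def card_insert_if split: if_splits)
  define P where "P vs \<longleftrightarrow> vs \<noteq> [] \<and> hd vs \<in> R \<and> set vs \<subseteq> V \<and> distinct vs \<and> successively (adjacent E) vs" for vs
  have reach_succ: "(adjacent E)\<^sup>*\<^sup>* (hd vs) x" if "successively (adjacent E) vs" "x \<in> set vs" for vs x
    using that
  proof (induction vs)
    case (Cons a vs)
    then show ?case
      by (cases vs) (auto intro: converse_rtranclp_into_rtranclp)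
  qed simp
  obtain v where v: "v \<in> V" "v \<notin> R" using assms by blast
  then obtain r where r: "r \<in> R" "(adjacent E)\<^sup>*\<^sup>* r v" using reach by blast
  obtain vs0 where vs0: "vs0 \<noteq> []" "hd vs0 = r" "last vs0 = v" "distinct vs0" "successively (adjacent E) vs0"
    using exists_simple_path[OF r(2)] by blast
  have "set vs0 \<subseteq> V"
  proof
    fix x assume "x \<in> set vs0"
    then have "(adjacent E)\<^sup>*\<^sup>* r x" using reach_succ[of vs0 x] vs0 by blast
    then show "x \<in> V" using r(1) assms(2) adjV by (cases rule: rtranclp.cases) auto
  qed
  then have P0: "P vs0" using vs0 r by (auto simp: P_def)
  \<comment> \<open>This path leads from a root to a non-root. A longest path therefore also has two
    vertices, so its end has a predecessor.\<close>
  have l0: "length vs0 \<ge> 2"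
    using vs0 r v by (cases vs0 rule: remdups_adj.cases) auto
  have "length vs < Suc (card V)" if "P vs" for vs
    using that card_mono[OF fin, of "set vs"] distinct_card[of vs] by (auto simp: P_def)
  then have "\<exists>vs. P vs \<and> (\<forall>us. P us \<longrightarrow> length us \<le> length vs)"
    using ex_has_greatest_nat[of P vs0 length "Suc (card V)"] P0 by (meson less_imp_le)
  then obtain vs where vs: "P vs" "\<And>us. P us \<Longrightarrow> length us \<le> length vs" by blast
  have l: "length vs \<ge> 2" using vs(2)[OF P0] l0 by simp
  then obtain us x z where uz: "vs = us @ [x, z]"
    by (metis One_nat_def Suc_1 append.assoc append_Cons append_Nil append_butlast_last_id
        le_zero_eq length_0_conv length_Cons list.size(3) nat.simps(3) not_less_eq_eq zero_le)
  have xz: "adjacent E x z" "z \<in> V" "distinct vs"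
    using vs(1) uz by (auto simp: P_def successively_append_iff)
  have "z \<notin> R"
  proof
    assume "z \<in> R"
    moreover have "(adjacent E)\<^sup>*\<^sup>* (hd vs) z" using vs(1) uz by (intro reach_succ) (auto simp: P_def)
    ultimately have "hd vs = z" using sep vs(1) by (auto simp: P_def)
    then show False using uz xz(3) by (cases us) auto
  qed
  \<comment> \<open>Another neighbour of the end \<open>z\<close> would extend the longest path or,
    if already on it, close a cycle.\<close>
  have only: "y = x" if y: "adjacent E z y" for y
  proof (rule ccontr)
    assume "y \<noteq> x"
    have "y \<noteq> z" using adjV y by blast
    show False
    proof (cases "y \<in> set vs")
      case False
      then have "P (vs @ [y])" using vs(1) y adjV[OF y] uz
        by (auto simp: P_def successively_append_iff hd_append)
      then show False using vs(2) by force
    next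
      case True
      then have "y \<in> set us" using uz \<open>y \<noteq> x\<close> \<open>y \<noteq> z\<close> by auto
      then obtain us1 us2 where us: "us = us1 @ y # us2" by (meson split_list)
      have "is_cycle E (y # us2 @ [x, z])"
      proof (rule successively_chord_is_cycle)
        show "successively (adjacent E) (y # us2 @ [x, z])"
          using vs(1) unfolding P_def uz us by (auto simp: successively_append_iff)
      qed (use xz(3) y in \<open>auto simp: uz us\<close>)
      then show False using nc by blast
    qed
  qed
  have "{e \<in> E. z \<in> e} = {{x, z}}"
  proof -
    have "e = {x, z}" if e: "e \<in> E" "z \<in> e" for e
    proof -
      have "card e = 2" using sg that by (auto simp: simple_graph_def)
      then obtain y where "e = {z, y}" using e(2) by (auto simp: card_2_iff)
      moreover from this have "y = x" using only[of y] e(1) by (simp add: adjacent_def)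
      ultimately show ?thesis by (simp add: insert_commute)
    qed
    moreover have "{x, z} \<in> E" using xz(1) by (simp add: adjacent_def)
    ultimately show ?thesis by blast
  qed
  then have "vertex_degree E z = 1" by (simp add: vertex_degree_def)
  then show ?thesis using xz(2) \<open>z \<notin> R\<close> by blast
qed

section \<open>Encoding forests by words\<close>

text \<open>Each letter is the neighbour of a deleted leaf. When the last non-root is deleted only
  roots remain, which forces the last letter into \<open>R\<close>; the guard admits the empty word
  for \<open>V = R\<close>.\<close>

definition code_words :: "'a set \<Rightarrow> 'a set \<Rightarrow> 'a list set" where
  "code_words V R = {xs. length xs = card (V - R) \<and> set xs \<subseteq> V \<and> (xs \<noteq> [] \<longrightarrow> last xs \<in> R)}"

definition code_degree :: "'a set \<Rightarrow> 'a set \<Rightarrow> 'a list \<Rightarrow> 'a \<Rightarrow> nat" where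
  "code_degree V R xs v = count_list xs v + (if v \<in> V - R then 1 else 0)"

lemma finite_code_words: "finite V \<Longrightarrow> finite (code_words V R)"
  by (rule finite_subset[OF _ finite_lists_length_eq[of V "card (V - R)"]]) (auto simp: code_words_def)

text \<open>Both sides split into fibres over the values satisfying \<open>P\<close>; joining the
  two images in \<open>D\<close> gives one finite index set for both. This turns equal counts for
  every degree function into equal counts for every event about degrees.\<close>

lemma card_eq_if_fibres_eq:
  assumes "finite A" "finite B"
    and "\<And>d. card {x \<in> A. f x = d} = card {y \<in> B. g y = d}"
  shows "card {x \<in> A. P (f x)} = card {y \<in> B. P (g y)}"
proof -
  define D where "D = {d \<in> f ` A \<union> g ` B. P d}"
  have D: "finite D" using assms by (simp add: D_def)
  have "card {x \<in> A. P (f x)} = (\<Sum>d\<in>D. card {x \<in> A. f x = d})"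
    by (subst card_UN_disjoint[symmetric]) (use assms D in \<open>auto simp: D_def intro!: arg_cong[where f=card]\<close>)
  moreover have "card {y \<in> B. P (g y)} = (\<Sum>d\<in>D. card {y \<in> B. g y = d})"
    by (subst card_UN_disjoint[symmetric]) (use assms D in \<open>auto simp: D_def intro!: arg_cong[where f=card]\<close>)
  ultimately show ?thesis using assms(3) by simp
qed

text \<open>The prescribed degree makes \<open>v\<close> a leaf, and the sum runs over its neighbour
  \<open>w\<close>. The degrees of the smaller forest are raised at \<open>v\<close> and
  \<open>w\<close> instead of lowering \<open>d\<close>, which avoids truncated subtraction.\<close>

lemma card_forests_leaf_recursion:
  assumes fin: "finite V" and R: "R \<subseteq> V" and v: "v \<in> V - R" and dv: "d v = 1"
  shows "card {E \<in> rooted_forests V R. vertex_degree E = d} =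
    (\<Sum>w\<in>V - {v}. card {E \<in> rooted_forests (V - {v}) R.
       (\<lambda>u. vertex_degree E u + (if u = v \<or> u = w then 1 else 0)) = d})"
proof -
  define A where "A w = {E \<in> rooted_forests (V - {v}) R.
       (\<lambda>u. vertex_degree E u + (if u = v \<or> u = w then 1 else 0)) = d}" for w
  have nv: "v \<notin> e" if "E \<in> rooted_forests (V - {v}) R" "e \<in> E" for E e
    using that by (auto simp: rooted_forests_def is_forest_def simple_graph_def)
  have finE: "finite E" if "E \<in> rooted_forests W R" "W \<subseteq> V" for E W
    by (rule finite_subset[of _ "Pow V"])
       (use that fin in \<open>auto simp: rooted_forests_def is_forest_def simple_graph_def\<close>)
  have deg: "vertex_degree (insert {v, w} E) = (\<lambda>u. vertex_degree E u + (if u = v \<or> u = w then 1 else 0))"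
    if "finite E" "\<And>e. e \<in> E \<Longrightarrow> v \<notin> e" for E w
  proof -
    have "{v, w} \<notin> E" using that(2) by blast
    then show ?thesis using vertex_degree_insert[OF that(1), of "{v, w}"] by (auto simp: fun_eq_iff)
  qed
  have "{E \<in> rooted_forests V R. vertex_degree E = d} = (\<Union>w\<in>V - {v}. insert {v, w} ` A w)" (is "?L = ?U")
  proof
    show "?U \<subseteq> ?L"
    proof
      fix F assume "F \<in> ?U"
      then obtain w E where w: "w \<in> V" "w \<noteq> v" and F: "F = insert {v, w} E" and E: "E \<in> A w" by blast
      have E': "E \<in> rooted_forests (V - {v}) R" using E by (simp add: A_def)
      have "F \<in> rooted_forests V R"
        unfolding F using insert_leaf_rooted_forests_iff[of v V R w E] v w R nv[OF E'] E' by blast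
      moreover have "vertex_degree F = d"
        unfolding F by (subst deg) (use finE[OF E'] nv[OF E'] E in \<open>auto simp: A_def\<close>)
      ultimately show "F \<in> ?L" by blast
    qed
    show "?L \<subseteq> ?U"
    proof
      fix F assume F: "F \<in> ?L"
      then have sg: "simple_graph V F" by (simp add: rooted_forests_def is_forest_def)
      have "card {e \<in> F. v \<in> e} = 1" using F dv by (auto simp: vertex_degree_def)
      then obtain e where e: "{e \<in> F. v \<in> e} = {e}" by (auto simp: card_1_singleton_iff)
      have eF: "e \<in> F" "v \<in> e" using e by auto
      then have "card e = 2" "e \<subseteq> V" using sg by (auto simp: simple_graph_def)
      then obtain w where w: "e = {v, w}" "w \<noteq> v" "w \<in> V" using eF(2) by (auto simp: card_2_iff)
      define E where "E = F - {e}"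
      have FE: "F = insert {v, w} E" using eF w by (auto simp: E_def)
      have nvE: "\<And>f. f \<in> E \<Longrightarrow> v \<notin> f" using e by (auto simp: E_def)
      have E: "E \<in> rooted_forests (V - {v}) R"
        using insert_leaf_rooted_forests_iff[of v V R w E] v w R nvE F FE by blast
      moreover have "vertex_degree F = d" using F by blast
      ultimately have "E \<in> A w"
        using deg[of E w] finE[OF E] nvE by (simp add: A_def FE)
      then show "F \<in> ?U" using w FE by blast
    qed
  qed
  moreover have "card (\<Union>w\<in>V - {v}. insert {v, w} ` A w) = (\<Sum>w\<in>V - {v}. card (insert {v, w} ` A w))"
  proof (rule card_UN_disjoint)
    show "finite (V - {v})" using fin by simp
    show "\<forall>w\<in>V - {v}. finite (insert {v, w} ` A w)"
      using finite_rooted_forests[of "V - {v}" R] fin by (auto simp: A_def)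
    show "\<forall>w\<in>V - {v}. \<forall>x\<in>V - {v}. w \<noteq> x \<longrightarrow> insert {v, w} ` A w \<inter> insert {v, x} ` A x = {}"
    proof (intro ballI impI)
      fix w x assume "w \<in> V - {v}" "x \<in> V - {v}" "w \<noteq> x"
      have False if "E \<in> A w" "G \<in> A x" "insert {v, w} E = insert {v, x} G" for E G
      proof -
        have "{v, w} \<in> insert {v, x} G" using that(3) by blast
        moreover have "{v, w} \<notin> G" using nv[of G "{v, w}"] that(2) by (auto simp: A_def)
        ultimately show False using \<open>w \<noteq> x\<close> by (auto simp: doubleton_eq_iff)
      qed
      then show "insert {v, w} ` A w \<inter> insert {v, x} ` A x = {}" by blast
    qed
  qed
  moreover have "card (insert {v, w} ` A w) = card (A w)" for w
  proof (rule card_image, rule inj_onI)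
    fix E G assume "E \<in> A w" "G \<in> A w" "insert {v, w} E = insert {v, w} G"
    moreover from this have "{v, w} \<notin> E" "{v, w} \<notin> G"
      using nv[of E "{v, w}"] nv[of G "{v, w}"] by (auto simp: A_def)
    ultimately show "E = G" using insert_ident by metis
  qed
  ultimately show ?thesis by (simp add: A_def)
qed

text \<open>The same recursion as for forests: a non-root of code degree one does not occur in the
  word, so all letters lie in \<open>V - {v}\<close>, and the first letter plays the part of the
  neighbour.\<close>

lemma card_code_words_recursion:
  assumes fin: "finite V" and R: "R \<subseteq> V" and v: "v \<in> V - R" and dv: "d v = 1"
  shows "card {xs \<in> code_words V R. code_degree V R xs = d} =
    (\<Sum>w\<in>V - {v}. card {xs \<in> code_words (V - {v}) R.
       (\<lambda>u. code_degree (V - {v}) R xs u + (if u = v \<or> u = w then 1 else 0)) = d})"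
proof -
  define A where "A w = {xs \<in> code_words (V - {v}) R.
       (\<lambda>u. code_degree (V - {v}) R xs u + (if u = v \<or> u = w then 1 else 0)) = d}" for w
  have cV: "card (V - R) = Suc (card (V - {v} - R))"
  proof -
    have "V - R = insert v (V - {v} - R)" using v by auto
    then show ?thesis using fin by (metis Diff_iff card_insert_disjoint finite_Diff insertI1)
  qed
  have deg: "code_degree V R (w # xs) = (\<lambda>u. code_degree (V - {v}) R xs u + (if u = v \<or> u = w then 1 else 0))"
    if "w \<noteq> v" for w xs
    using that v by (auto simp: code_degree_def fun_eq_iff)
  have "{xs \<in> code_words V R. code_degree V R xs = d} = (\<Union>w\<in>V - {v}. (#) w ` A w)" (is "?L = ?U")
  proof
    show "?L \<subseteq> ?U"
    proof
      fix ys assume ys: "ys \<in> ?L"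
      then obtain w xs where wx: "ys = w # xs" "w \<in> V" using cV by (cases ys) (auto simp: code_words_def)
      have "code_degree V R ys v = 1" using ys dv by auto
      then have "v \<notin> set ys" using v by (auto simp: code_degree_def count_list_0_iff)
      then have wv: "w \<noteq> v" "v \<notin> set xs" using wx by auto
      have "xs \<in> code_words (V - {v}) R"
        using ys wv wx cV by (auto simp: code_words_def)
      then have "xs \<in> A w" using ys wv wx deg[of w xs] by (simp add: A_def)
      then show "ys \<in> ?U" using wx wv by blast
    qed
    show "?U \<subseteq> ?L"
    proof
      fix ys assume "ys \<in> ?U"
      then obtain w xs where wx: "ys = w # xs" "w \<in> V" "w \<noteq> v" "xs \<in> A w" by blast
      \<comment> \<open>If the remaining word is empty, \<open>v\<close> was the only non-root, so
        the single letter \<open>w\<close> meets the condition on last letters.\<close>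
      have ne: "xs = [] \<Longrightarrow> w \<in> R"
      proof -
        assume "xs = []"
        then have "V - {v} - R = {}" using wx(4) fin by (auto simp: A_def code_words_def)
        then show "w \<in> R" using wx by blast
      qed
      have "ys \<in> code_words V R" using wx cV ne by (auto simp: A_def code_words_def)
      then show "ys \<in> ?L" using deg[of w xs] wx by (simp add: A_def)
    qed
  qed
  moreover have "card (\<Union>w\<in>V - {v}. (#) w ` A w) = (\<Sum>w\<in>V - {v}. card ((#) w ` A w))"
    by (rule card_UN_disjoint)
       (use fin finite_code_words[of "V - {v}" R] in \<open>auto simp: A_def\<close>)
  moreover have "card ((#) w ` A w) = card (A w)" for w
    by (rule card_image) simp
  ultimately show ?thesis by (simp add: A_def)
qed

text \<open>If every non-root occurred, all would occur before the last letter, which is a root;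
  there is one position too few for that.\<close>

lemma code_words_leaf:
  assumes "finite V" "R \<subseteq> V" "R \<noteq> V" "xs \<in> code_words V R"
  shows "\<exists>v\<in>V - R. code_degree V R xs v = 1"
proof (rule ccontr)
  assume "\<not> ?thesis"
  then have all: "V - R \<subseteq> set xs" by (force simp: code_degree_def count_list_0_iff)
  have "card (V - R) > 0" using assms by (auto simp: card_gt_0_iff)
  then have ne: "xs \<noteq> []" and len: "length xs = card (V - R)" and last: "last xs \<in> R"
    using assms by (auto simp: code_words_def)
  have "V - R \<subseteq> set (butlast xs)"
  proof -
    have "set xs = insert (last xs) (set (butlast xs))"
      using arg_cong[OF append_butlast_last_id[OF ne], of set] by simp
    then show ?thesis using all last by auto
  qed
  then have "card (V - R) \<le> length (butlast xs)"
    using card_mono[of "set (butlast xs)"] card_length[of "butlast xs"] by (meson List.finite_set le_trans)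
  moreover have "length (butlast xs) < length xs" using ne by simp
  ultimately show False using len by simp
qed

text \<open>
  Deleting a non-root leaf \<open>v\<close> with neighbour \<open>w\<close> corresponds to dropping the first letter \<open>w\<close> of the
  code; once the degrees are prescribed, it does not matter which leaf is taken.
\<close>
lemma card_forests_degree_eq_card_code_words:
  assumes "finite V" "R \<subseteq> V"
  shows "card {E \<in> rooted_forests V R. vertex_degree E = d} =
         card {xs \<in> code_words V R. code_degree V R xs = d}"
  using assms
proof (induction "card (V - R)" arbitrary: V d)
  case 0
  then have "V = R" by auto
  have "vertex_degree {} = (\<lambda>u. 0)" "code_degree R R [] = (\<lambda>u. 0)"
    by (auto simp: vertex_degree_def code_degree_def fun_eq_iff)
  moreover have "code_words R R = {[]}" by (auto simp: code_words_def)
  ultimately have "{E \<in> rooted_forests V R. vertex_degree E = d} = (if d = (\<lambda>u. 0) then {{}} else {})"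
    "{xs \<in> code_words V R. code_degree V R xs = d} = (if d = (\<lambda>u. 0) then {[]} else {})"
    unfolding \<open>V = R\<close> rooted_forests_all_roots by auto
  then show ?case by simp
next
  case (Suc k)
  then have "R \<noteq> V" by auto
  show ?case
  proof (cases "\<exists>v\<in>V - R. d v = 1")
    \<comment> \<open>A degree function without a non-root of degree one is attained by no forest
      and by no word, so both counts are zero.\<close>
    case False
    then have "{E \<in> rooted_forests V R. vertex_degree E = d} = {}"
      "{xs \<in> code_words V R. code_degree V R xs = d} = {}"
      using rooted_forests_leaf[OF Suc.prems \<open>R \<noteq> V\<close>] code_words_leaf[OF Suc.prems \<open>R \<noteq> V\<close>] by blast+
    then show ?thesis by (metis card.empty)
  next
    case True
    then obtain v where v: "v \<in> V - R" "d v = 1" by blast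
    have "V - {v} - R = V - R - {v}" by blast
    then have "k = card (V - {v} - R)" using v Suc.hyps(2) Suc.prems(1) by simp
    then have IH: "card {E \<in> rooted_forests (V - {v}) R. vertex_degree E = d'} =
         card {xs \<in> code_words (V - {v}) R. code_degree (V - {v}) R xs = d'}" for d'
      using Suc.hyps(1)[of "V - {v}" d'] Suc.prems v by auto
    \<comment> \<open>The summands constrain the degrees only after the shift at \<open>v\<close>
      and \<open>w\<close>; the fibre lemma carries the induction hypothesis over to such
      conditions.\<close>
    have "card {E \<in> rooted_forests (V - {v}) R.
         (\<lambda>u. vertex_degree E u + (if u = v \<or> u = w then 1 else 0)) = d} =
       card {xs \<in> code_words (V - {v}) R.
         (\<lambda>u. code_degree (V - {v}) R xs u + (if u = v \<or> u = w then 1 else 0)) = d}" for w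
      by (rule card_eq_if_fibres_eq[OF _ _ IH, where P = "\<lambda>f. (\<lambda>u. f u + (if u = v \<or> u = w then 1 else 0)) = d"])
         (use Suc.prems in \<open>auto intro: finite_rooted_forests finite_code_words\<close>)
    then show ?thesis
      using card_forests_leaf_recursion[OF Suc.prems v(1), of d] card_code_words_recursion[OF Suc.prems v(1), of d] v(2) by simp
  qed
qed

lemma card_forests_eq_card_code_words:
  assumes "finite V" "R \<subseteq> V"
  shows "card {E \<in> rooted_forests V R. P (vertex_degree E)} =
         card {xs \<in> code_words V R. P (code_degree V R xs)}"
  using assms by (intro card_eq_if_fibres_eq[where P = P] finite_rooted_forests finite_code_words
      card_forests_degree_eq_card_code_words)

section \<open>Letter counts in words\<close>

definition lists_of_length :: "'a set \<Rightarrow> nat \<Rightarrow> 'a list set" where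
  "lists_of_length V m = {xs. set xs \<subseteq> V \<and> length xs = m}"

lemma lists_of_length_0 [simp]: "lists_of_length V 0 = {[]}"
  by (auto simp: lists_of_length_def)

lemma finite_lists_of_length: "finite V \<Longrightarrow> finite (lists_of_length V m)"
  by (simp add: lists_of_length_def finite_lists_length_eq)

lemma card_lists_of_length: "finite V \<Longrightarrow> card (lists_of_length V m) = card V ^ m"
  by (simp add: lists_of_length_def card_lists_length_eq)

lemma card_lists_of_length_Suc:
  assumes "finite V"
  shows "card {xs \<in> lists_of_length V (Suc m). P xs} = (\<Sum>x\<in>V. card {xs \<in> lists_of_length V m. P (x # xs)})"
proof -
  have "{xs \<in> lists_of_length V (Suc m). P xs} = (\<Union>x\<in>V. (#) x ` {xs \<in> lists_of_length V m. P (x # xs)})"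
    by (auto simp: lists_of_length_def length_Suc_conv image_iff)
  also have "card \<dots> = (\<Sum>x\<in>V. card ((#) x ` {xs \<in> lists_of_length V m. P (x # xs)}))"
    by (rule card_UN_disjoint) (use assms finite_lists_of_length[OF assms] in auto)
  also have "\<dots> = (\<Sum>x\<in>V. card {xs \<in> lists_of_length V m. P (x # xs)})"
    by (intro sum.cong card_image) auto
  finally show ?thesis .
qed

text \<open>A union bound over the positions of \<open>k\<close> occurrences, with denominators
  cleared. Splitting off the first letter reduces the induction step to Pascal's rule.\<close>

lemma card_count_list_ge_le:
  assumes "finite V" "v \<in> V"
  shows "card {xs \<in> lists_of_length V m. k \<le> count_list xs v} * card V ^ k \<le> (m choose k) * card V ^ m"
proof (induction m arbitrary: k)
  case 0
  then show ?case by (cases k) (auto intro: finite_subset)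
next
  case (Suc m)
  show ?case
  proof (cases k)
    case 0
    then show ?thesis using card_lists_of_length[OF assms(1), of "Suc m"] by simp
  next
    case (Suc j)
    define N where "N = card V"
    define T where "T i = card {xs \<in> lists_of_length V m. i \<le> count_list xs v}" for i
    have N: "N = Suc (card (V - {v}))" unfolding N_def using assms by (rule card.remove)
    have "card {xs \<in> lists_of_length V (Suc m). k \<le> count_list xs v} =
        (\<Sum>x\<in>V. if x = v then T j else T (Suc j))"
      unfolding card_lists_of_length_Suc[OF assms(1)] T_def Suc by (intro sum.cong) simp_all
    also have "\<dots> = T j + (N - 1) * T (Suc j)"
      by (subst sum.remove[OF assms]) (simp add: N)
    finally have "card {xs \<in> lists_of_length V (Suc m). k \<le> count_list xs v} * N ^ k =
        N * (T j * N ^ j) + (N - 1) * (T (Suc j) * N ^ Suc j)"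
      by (simp add: Suc algebra_simps)
    also have "\<dots> \<le> N * ((m choose j) * N ^ m) + N * ((m choose Suc j) * N ^ m)"
      unfolding T_def N_def by (rule add_mono[OF mult_le_mono mult_le_mono]) (use Suc.IH[of j] Suc.IH[of "Suc j"] in auto)
    also have "\<dots> = (Suc m choose k) * N ^ Suc m"
      by (simp add: Suc algebra_simps)
    finally show ?thesis by (simp add: N_def)
  qed
qed

text \<open>The \<open>i\<close> places of \<open>u\<close> are chosen freely and the other letters
  form any word without \<open>u\<close>. The predicate on that word lets a second count be imposed;
  it varies in the induction because a first letter different from \<open>u\<close> is absorbed into
  it.\<close>

lemma card_count_list_eq_filter:
  assumes "finite V" "u \<in> V"
  shows "card {xs \<in> lists_of_length V m. count_list xs u = i \<and> P (filter (\<lambda>x. x \<noteq> u) xs)} =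
         (m choose i) * card {xs \<in> lists_of_length (V - {u}) (m - i). P xs}"
proof (induction m arbitrary: i P)
  case 0
  then show ?case by (cases i) (auto intro!: arg_cong[where f = card])
next
  case (Suc m)
  let ?Z = "\<lambda>m P. card {xs \<in> lists_of_length (V - {u}) m. P xs}"
  let ?A = "\<lambda>i P. card {xs \<in> lists_of_length V m. count_list xs u = i \<and> P (filter (\<lambda>x. x \<noteq> u) xs)}"
  have Z: "?Z (Suc m') P = (\<Sum>x\<in>V - {u}. ?Z m' (\<lambda>xs. P (x # xs)))" for m' P
    using assms(1) by (intro card_lists_of_length_Suc) auto
  have "card {xs \<in> lists_of_length V (Suc m). count_list xs u = i \<and> P (filter (\<lambda>x. x \<noteq> u) xs)} =
      card {xs \<in> lists_of_length V m. Suc (count_list xs u) = i \<and> P (filter (\<lambda>x. x \<noteq> u) xs)} +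
      (\<Sum>x\<in>V - {u}. ?A i (\<lambda>xs. P (x # xs)))"
    unfolding card_lists_of_length_Suc[OF assms(1)] sum.remove[OF assms]
    by (intro arg_cong2[where f = "(+)"] sum.cong) (auto intro!: arg_cong[where f = card])
  also have "(\<Sum>x\<in>V - {u}. ?A i (\<lambda>xs. P (x # xs))) =
      (m choose i) * (\<Sum>x\<in>V - {u}. ?Z (m - i) (\<lambda>xs. P (x # xs)))"
    unfolding sum_distrib_left by (intro sum.cong refl Suc.IH)
  finally have eq: "card {xs \<in> lists_of_length V (Suc m). count_list xs u = i \<and> P (filter (\<lambda>x. x \<noteq> u) xs)} =
      card {xs \<in> lists_of_length V m. Suc (count_list xs u) = i \<and> P (filter (\<lambda>x. x \<noteq> u) xs)} +
      (m choose i) * ?Z (Suc (m - i)) P" unfolding Z .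
  show ?case
  proof (cases i)
    case 0
    then show ?thesis using eq by simp
  next
    case (Suc j)
    \<comment> \<open>For \<open>Suc j > m\<close> truncated subtraction may make the two word
      lengths differ, but then the binomial coefficient is zero.\<close>
    have "(m choose Suc j) * ?Z (Suc (m - Suc j)) P = (m choose Suc j) * ?Z (m - j) P"
    proof (cases "Suc j \<le> m")
      case True
      then have "Suc (m - Suc j) = m - j" by simp
      then show ?thesis by simp
    next
      case False
      then show ?thesis by simp
    qed
    then show ?thesis using eq Suc.IH[of j P] by (simp add: Suc algebra_simps)
  qed
qed

lemma card_count_list_eq:
  assumes "finite V" "u \<in> V"
  shows "card {xs \<in> lists_of_length V m. count_list xs u = i} = (m choose i) * (card V - 1) ^ (m - i)"
  using card_count_list_eq_filter[OF assms, of m i "\<lambda>_. True"] card_lists_of_length[of "V - {u}" "m - i"] assms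
  by simp

lemma count_list_filter: "P v \<Longrightarrow> count_list (filter P xs) v = count_list xs v"
  by (induction xs) auto

lemma card_two_count_list_eq:
  assumes "finite V" "u \<in> V" "v \<in> V" "u \<noteq> v"
  shows "card {xs \<in> lists_of_length V m. count_list xs u = i \<and> count_list xs v = j} =
    (m choose i) * ((m - i choose j) * (card V - 2) ^ (m - i - j))"
proof -
  have "card {xs \<in> lists_of_length V m. count_list xs u = i \<and> count_list xs v = j} =
    card {xs \<in> lists_of_length V m. count_list xs u = i \<and> count_list (filter (\<lambda>x. x \<noteq> u) xs) v = j}"
    using assms(4) by (simp add: count_list_filter)
  also have "\<dots> = (m choose i) * card {xs \<in> lists_of_length (V - {u}) (m - i). count_list xs v = j}"
    using card_count_list_eq_filter[OF assms(1,2), of m i "\<lambda>xs. count_list xs v = j"] .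
  also have "card {xs \<in> lists_of_length (V - {u}) (m - i). count_list xs v = j} =
      (m - i choose j) * (card (V - {u}) - 1) ^ (m - i - j)"
    using assms by (intro card_count_list_eq) auto
  also have "card (V - {u}) - 1 = card V - 2" using assms by simp
  finally show ?thesis .
qed

text \<open>Chebyshev's inequality in counting form: each zero of \<open>X\<close> contributes
  \<open>e\<^sup>2\<close> to the sum of squared deviations from the mean \<open>e\<close>.\<close>

lemma card_zero_second_moment:
  fixes X :: "'a \<Rightarrow> real" and e :: real
  assumes "finite A" "A \<noteq> {}" and e: "e = (\<Sum>x\<in>A. X x) / card A"
  shows "card {x \<in> A. X x = 0} * e\<^sup>2 \<le> (\<Sum>x\<in>A. (X x)\<^sup>2) - card A * e\<^sup>2"
proof -
  have s: "(\<Sum>x\<in>A. X x) = card A * e" using assms by (simp add: e)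
  have "card {x \<in> A. X x = 0} * e\<^sup>2 = (\<Sum>x | x \<in> A \<and> X x = 0. (X x - e)\<^sup>2)" by simp
  also have "\<dots> \<le> (\<Sum>x\<in>A. (X x - e)\<^sup>2)"
    using assms(1) by (intro sum_mono2) auto
  also have "\<dots> = (\<Sum>x\<in>A. (X x)\<^sup>2) - 2 * e * (\<Sum>x\<in>A. X x) + card A * e\<^sup>2"
    unfolding power2_diff sum.distrib sum_subtractf sum_distrib_left by (simp add: mult_ac)
  also have "\<dots> = (\<Sum>x\<in>A. (X x)\<^sup>2) - card A * e\<^sup>2"
    by (simp add: s power2_eq_square)
  finally show ?thesis .
qed

text \<open>Second moment method for the number \<open>X\<close> of letters in \<open>U\<close> that
  occur exactly \<open>k\<close> times, with mean \<open>e\<close>. The diagonal of the second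
  moment contributes \<open>1 / e\<close>, the pairs of distinct letters contribute the
  power.\<close>

lemma card_no_count_list_eq_le:
  fixes e :: real
  assumes V: "finite V" and U: "U \<subseteq> V" "U \<noteq> {}" and n: "card V \<ge> 3" and k: "k \<le> m"
    and e: "e = real (card U) * ((m choose k) * (real (card V) - 1) ^ (m - k)) / real (card V) ^ m"
  shows "card {xs \<in> lists_of_length V m. \<forall>v\<in>U. count_list xs v \<noteq> k} / real (card V) ^ m
    \<le> 1 / e + ((real (card V) - 1) / (real (card V) - 2)) ^ (2 * k) - 1"
proof -
  define n where "n = real (card V)"
  define L where "L = lists_of_length V m"
  \<comment> \<open>\<open>p1\<close> and \<open>p2\<close> count the words in which one given
    letter, or each of two given distinct letters, occurs exactly \<open>k\<close> times.\<close>
  define p1 where "p1 = (m choose k) * (n - 1) ^ (m - k)"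
  define p2 where "p2 = (m choose k) * ((m - k choose k) * (n - 2) ^ (m - k - k))"
  define I where "I v xs = (of_bool (count_list xs v = k) :: real)" for v :: 'a and xs
  define X where "X xs = (\<Sum>v\<in>U. I v xs)" for xs
  define q where "q = real (card U)"
  define \<rho> where "\<rho> = ((n - 1) / (n - 2)) ^ (2 * k)"
  have n3: "n \<ge> 3" using n by (simp add: n_def)
  have finL: "finite L" and cL: "real (card L) = n ^ m"
    using V by (simp_all add: L_def finite_lists_of_length card_lists_of_length n_def)
  have finU: "finite U" using U V finite_subset by blast
  have q: "q > 0" using U finU by (simp add: q_def card_gt_0_iff)
  have s1: "(\<Sum>xs\<in>L. I v xs) = p1" if "v \<in> U" for v
  proof -
    have "(\<Sum>xs\<in>L. I v xs) = card {xs \<in> L. count_list xs v = k}"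
      using finL by (simp add: I_def Int_def)
    also have "\<dots> = p1"
      using card_count_list_eq[OF V, of v m k] that U(1) n
      by (auto simp: L_def p1_def n_def of_nat_diff)
    finally show ?thesis .
  qed
  have s2: "(\<Sum>xs\<in>L. I u xs * I v xs) = p2" if "u \<in> U" "v \<in> U" "u \<noteq> v" for u v
  proof -
    have "(\<Sum>xs\<in>L. I u xs * I v xs) = (\<Sum>xs\<in>L. of_bool (count_list xs u = k \<and> count_list xs v = k))"
      by (intro sum.cong) (auto simp: I_def)
    also have "\<dots> = card {xs \<in> L. count_list xs u = k \<and> count_list xs v = k}"
      using finL by (simp add: Int_def)
    also have "\<dots> = p2"
    proof -
      have "u \<in> V" "v \<in> V" using that U(1) by auto
      then show ?thesis using card_two_count_list_eq[OF V _ _ that(3), of m k k] n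
        by (simp add: L_def p2_def n_def of_nat_diff)
    qed
    finally show ?thesis .
  qed
  have p1: "p1 > 0" using k n3 by (simp add: p1_def)
  have sX: "(\<Sum>xs\<in>L. X xs) = q * p1"
    unfolding X_def by (subst sum.swap) (simp add: s1 q_def)
  have e': "e = (\<Sum>xs\<in>L. X xs) / card L"
    by (simp add: e sX cL n_def p1_def q_def)
  have e0: "e > 0" using q p1 n3 by (simp add: e' sX cL)
  have sX2: "(\<Sum>xs\<in>L. (X xs)\<^sup>2) = q * p1 + q * (q - 1) * p2"
  proof -
    have "(\<Sum>xs\<in>L. (X xs)\<^sup>2) = (\<Sum>xs\<in>L. \<Sum>u\<in>U. \<Sum>v\<in>U. I u xs * I v xs)"
      by (simp add: X_def power2_eq_square sum_product)
    also have "\<dots> = (\<Sum>u\<in>U. \<Sum>v\<in>U. \<Sum>xs\<in>L. I u xs * I v xs)"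
      by (subst sum.swap, intro sum.cong refl, rule sum.swap)
    also have "\<dots> = (\<Sum>u\<in>U. \<Sum>v\<in>U. if v = u then p1 else p2)"
    proof (intro sum.cong refl)
      fix u v assume uv: "u \<in> U" "v \<in> U"
      have "(\<Sum>xs\<in>L. I u xs * I u xs) = (\<Sum>xs\<in>L. I u xs)" by (intro sum.cong) (auto simp: I_def)
      then show "(\<Sum>xs\<in>L. I u xs * I v xs) = (if v = u then p1 else p2)"
        using s1 s2 uv by auto
    qed
    also have "\<dots> = (\<Sum>u\<in>U. p1 + (q - 1) * p2)"
    proof (intro sum.cong refl)
      fix u assume u: "u \<in> U"
      have "(\<Sum>v\<in>U. if v = u then p1 else p2) = p1 + real (card (U - {u})) * p2"
        by (subst sum.remove[OF finU u]) simp
      also have "real (card (U - {u})) = q - 1"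
        using finU u card.remove[of U u] by (simp add: q_def)
      finally show "(\<Sum>v\<in>U. if v = u then p1 else p2) = p1 + (q - 1) * p2" .
    qed
    also have "\<dots> = q * p1 + q * (q - 1) * p2" by (simp add: q_def algebra_simps)
    finally show ?thesis .
  qed
  \<comment> \<open>Two counts are nearly uncorrelated because \<open>n (n - 2) \<le> (n - 1)\<^sup>2\<close>.\<close>
  have p2: "p2 * n ^ m \<le> \<rho> * p1\<^sup>2"
  proof (cases "2 * k \<le> m")
    case False
    \<comment> \<open>Two letters cannot both fill \<open>k\<close> of fewer than
      \<open>2 * k\<close> places.\<close>
    then have "m - k < k" by simp
    then have "p2 = 0" by (simp add: p2_def)
    then show ?thesis using n3 by (simp add: \<rho>_def)
  next
    case True
    have "n * (n - 2) \<le> (n - 1)\<^sup>2" by (simp add: power2_eq_square algebra_simps)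
    then have "(n * (n - 2)) ^ m \<le> ((n - 1)\<^sup>2) ^ m" using n3 by (intro power_mono) auto
    then have A: "n ^ m * (n - 2) ^ m \<le> (n - 1) ^ (2 * m)"
      by (simp add: power_mult_distrib power_mult)
    have B: "(n - 2) ^ m = (n - 2) ^ (m - k - k) * (n - 2) ^ (2 * k)"
      using True by (simp add: power_add[symmetric])
    have C: "(n - 1) ^ (2 * m) = ((n - 1) ^ (m - k))\<^sup>2 * (n - 1) ^ (2 * k)"
      using k by (simp add: power_mult[symmetric] power_add[symmetric] algebra_simps)
    have "(n - 2) ^ (m - k - k) * n ^ m * (n - 2) ^ (2 * k) \<le> ((n - 1) ^ (m - k))\<^sup>2 * (n - 1) ^ (2 * k)"
      using A unfolding B C by (simp add: mult_ac)
    then have D: "(n - 2) ^ (m - k - k) * n ^ m \<le> ((n - 1) ^ (m - k))\<^sup>2 * \<rho>"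
      using n3 by (simp add: \<rho>_def power_divide field_simps)
    have "(m - k choose k) \<le> (m choose k)" by (rule binomial_right_mono) simp
    then have "p2 * n ^ m \<le> (m choose k) * (m choose k) * ((n - 2) ^ (m - k - k) * n ^ m)"
      using n3 by (auto simp: p2_def mult_ac intro!: mult_left_mono)
    also have "\<dots> \<le> (m choose k) * (m choose k) * (((n - 1) ^ (m - k))\<^sup>2 * \<rho>)"
      using D by (intro mult_left_mono) auto
    also have "\<dots> = \<rho> * p1\<^sup>2" by (simp add: p1_def power2_eq_square mult_ac)
    finally show ?thesis .
  qed
  have nm: "n ^ m > 0" using n3 by simp
  have neL: "L \<noteq> {}"
  proof
    assume "L = {}"
    then have "n ^ m = 0" using cL by (simp only: card.empty of_nat_0)
    then show False using nm by linarith
  qed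
  have "X xs = 0 \<longleftrightarrow> (\<forall>v\<in>U. count_list xs v \<noteq> k)" for xs
    unfolding X_def by (subst sum_nonneg_eq_0_iff) (use finU in \<open>auto simp: I_def\<close>)
  then have "card {xs \<in> L. \<forall>v\<in>U. count_list xs v \<noteq> k} * e\<^sup>2 \<le> (\<Sum>xs\<in>L. (X xs)\<^sup>2) - n ^ m * e\<^sup>2"
    using card_zero_second_moment[OF finL _ e'] neL cL by simp
  also have "\<dots> \<le> n ^ m * (e + \<rho> * e\<^sup>2 - e\<^sup>2)"
  proof -
    have eq: "q * p1 = n ^ m * e" using n3 by (simp add: e' sX cL)
    have "q * (q - 1) * p2 \<le> q\<^sup>2 * p2"
      using q n3 by (auto simp: p2_def power2_eq_square intro!: mult_right_mono mult_left_mono)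
    moreover have "q\<^sup>2 * p2 * n ^ m \<le> \<rho> * (q * p1)\<^sup>2"
      using mult_left_mono[OF p2, of "q\<^sup>2"] by (simp add: power_mult_distrib mult_ac)
    then have "q\<^sup>2 * p2 * n ^ m \<le> (\<rho> * e\<^sup>2 * n ^ m) * n ^ m"
      unfolding eq by (simp add: power2_eq_square mult_ac)
    then have "q\<^sup>2 * p2 \<le> \<rho> * e\<^sup>2 * n ^ m" using nm by (simp only: mult_le_cancel_right_pos)
    ultimately have "q * p1 + q * (q - 1) * p2 \<le> n ^ m * e + \<rho> * e\<^sup>2 * n ^ m" using eq by linarith
    then show ?thesis unfolding sX2 by (simp add: algebra_simps)
  qed
  finally have "card {xs \<in> L. \<forall>v\<in>U. count_list xs v \<noteq> k} / n ^ m * e\<^sup>2 \<le> e + \<rho> * e\<^sup>2 - e\<^sup>2"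
    using nm by (simp add: pos_divide_le_eq mult.commute[of _ "n ^ m"])
  then have "card {xs \<in> L. \<forall>v\<in>U. count_list xs v \<noteq> k} / n ^ m \<le> (e + \<rho> * e\<^sup>2 - e\<^sup>2) / e\<^sup>2"
    using e0 by (simp only: pos_le_divide_eq zero_less_power)
  also have "\<dots> = 1 / e + \<rho> - 1" using e0 by (simp add: field_simps power2_eq_square)
  finally show ?thesis by (simp add: L_def n_def \<rho>_def)
qed

section \<open>Degrees in random forests\<close>

text \<open>Splitting off the last letter writes the code words as a product of all words of length
  \<open>n - t - 1\<close> and the \<open>t\<close> roots. As \<open>Q\<close> ignores that letter,
  the factor \<open>t\<close> cancels and a uniform word remains.\<close>

lemma prob_random_forest_le:
  assumes t: "1 \<le> t" "t < n"
    and PQ: "\<And>ys r. r \<in> {1..t} \<Longrightarrow> P (code_degree {1..n} {1..t} (ys @ [r])) \<Longrightarrow> Q ys"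
  shows "measure_pmf.prob (random_forest n t) {F. P (vertex_degree F)}
    \<le> card {ys \<in> lists_of_length {1..n} (n - t - 1). Q ys} / real n ^ (n - t - 1)"
proof -
  let ?m = "n - t - 1" and ?V = "{1..n}" and ?R = "{1..t}"
  let ?L = "lists_of_length ?V ?m"
  define f where "f = (\<lambda>(ys, r). ys @ [r] :: nat list)"
  have sub: "?R \<subseteq> ?V" using t by auto
  have cVR: "card (?V - ?R) = Suc ?m" using t by (subst card_Diff_subset) auto
  have inj: "inj_on f A" for A by (auto simp: f_def inj_on_def)
  have cw: "code_words ?V ?R = f ` (?L \<times> ?R)"
  proof
    show "code_words ?V ?R \<subseteq> f ` (?L \<times> ?R)"
    proof
      fix xs assume xs: "xs \<in> code_words ?V ?R"
      then have l: "length xs = Suc ?m" using cVR by (simp add: code_words_def)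
      then have "xs \<noteq> []" by auto
      then have "xs = f (butlast xs, last xs)" by (simp add: f_def)
      moreover have "(butlast xs, last xs) \<in> ?L \<times> ?R"
        using xs l \<open>xs \<noteq> []\<close> by (auto simp: code_words_def lists_of_length_def dest: in_set_butlastD)
      ultimately show "xs \<in> f ` (?L \<times> ?R)" by blast
    qed
    show "f ` (?L \<times> ?R) \<subseteq> code_words ?V ?R"
    proof
      fix xs assume "xs \<in> f ` (?L \<times> ?R)"
      then obtain ys r where "xs = ys @ [r]" "ys \<in> ?L" "r \<in> ?R" by (auto simp: f_def)
      then show "xs \<in> code_words ?V ?R"
        using subsetD[OF sub, of r] cVR by (simp add: code_words_def lists_of_length_def)
    qed
  qed
  have finL: "finite ?L" by (simp add: finite_lists_of_length)
  have total: "card (forests n t) = n ^ ?m * t"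
  proof -
    have "card (forests n t) = card (code_words ?V ?R)"
      using card_forests_eq_card_code_words[of ?V ?R "\<lambda>_. True"] sub t
      by (simp add: forests_eq_rooted_forests)
    also have "\<dots> = n ^ ?m * t"
      unfolding cw by (subst card_image[OF inj]) (simp add: card_cartesian_product card_lists_of_length)
    finally show ?thesis .
  qed
  have "card {F \<in> forests n t. P (vertex_degree F)} = card {xs \<in> code_words ?V ?R. P (code_degree ?V ?R xs)}"
    using card_forests_eq_card_code_words[of ?V ?R P] sub t by (simp add: forests_eq_rooted_forests)
  also have "\<dots> \<le> card (f ` ({ys \<in> ?L. Q ys} \<times> ?R))"
  proof (rule card_mono)
    show "finite (f ` ({ys \<in> ?L. Q ys} \<times> ?R))" using finL by simp
    show "{xs \<in> code_words ?V ?R. P (code_degree ?V ?R xs)} \<subseteq> f ` ({ys \<in> ?L. Q ys} \<times> ?R)"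
    proof
      fix xs assume xs: "xs \<in> {xs \<in> code_words ?V ?R. P (code_degree ?V ?R xs)}"
      then obtain ys r where ys: "xs = f (ys, r)" "ys \<in> ?L" "r \<in> ?R" unfolding cw by blast
      then have "Q ys" using xs PQ[of r ys] by (simp add: f_def)
      then show "xs \<in> f ` ({ys \<in> ?L. Q ys} \<times> ?R)" using ys by blast
    qed
  qed
  also have "\<dots> = card {ys \<in> ?L. Q ys} * t"
    by (subst card_image[OF inj]) (simp add: card_cartesian_product)
  finally have le: "card {F \<in> forests n t. P (vertex_degree F)} \<le> card {ys \<in> ?L. Q ys} * t" .
  have "measure_pmf.prob (random_forest n t) {F. P (vertex_degree F)} =
      card {F \<in> forests n t. P (vertex_degree F)} / card (forests n t)"
    unfolding random_forest_def using forests_nonempty[of t n] t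
    by (subst measure_pmf_of_set) (auto simp: finite_forests Int_def)
  also have "\<dots> \<le> real (card {ys \<in> ?L. Q ys} * t) / real (n ^ ?m * t)"
    unfolding total using le by (intro divide_right_mono) (simp_all only: of_nat_le_iff of_nat_0_le_iff)
  also have "\<dots> = card {ys \<in> ?L. Q ys} / real n ^ ?m" using t by simp
  finally show ?thesis .
qed

text \<open>The last letter can add one to the degree of a root, and every non-root gets one extra,
  but never both apply. So a degree above \<open>k\<close> forces \<open>k\<close> occurrences
  before the last letter. In the union bound, \<open>fact k\<close> times the binomial coefficient
  is at most \<open>n ^ k\<close>.\<close>

lemma prob_random_forest_degree_gt:
  assumes t: "1 \<le> t" "t < n" and S: "S \<subseteq> {1..n}"
  shows "measure_pmf.prob (random_forest n t) {F. \<exists>v\<in>S. k < vertex_degree F v} \<le> card S / fact k"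
proof -
  let ?m = "n - t - 1"
  let ?L = "lists_of_length {1..n} ?m"
  have finL: "finite ?L" by (simp add: finite_lists_of_length)
  have finS: "finite S" using S finite_subset by blast
  have "measure_pmf.prob (random_forest n t) {F. \<exists>v\<in>S. k < vertex_degree F v}
      \<le> card {ys \<in> ?L. \<exists>v\<in>S. k \<le> count_list ys v} / real n ^ ?m"
  proof (rule prob_random_forest_le[OF t, where P = "\<lambda>d. \<exists>v\<in>S. k < d v"])
    fix ys r assume r: "r \<in> {1..t}" and "\<exists>v\<in>S. k < code_degree {1..n} {1..t} (ys @ [r]) v"
    then obtain v where v: "v \<in> S" "k < code_degree {1..n} {1..t} (ys @ [r]) v" by blast
    then have "k \<le> count_list ys v" using r by (auto simp: code_degree_def split: if_splits)
    with v show "\<exists>v\<in>S. k \<le> count_list ys v" by blast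
  qed
  also have "\<dots> \<le> card S / fact k"
  proof -
    have each: "card {ys \<in> ?L. k \<le> count_list ys v} \<le> real n ^ ?m / fact k" if "v \<in> S" for v
    proof -
      have "card {ys \<in> ?L. k \<le> count_list ys v} * n ^ k * fact k \<le> (?m choose k) * n ^ ?m * fact k"
        using card_count_list_ge_le[of "{1..n}" v ?m k] that S by auto
      also have "\<dots> \<le> ?m ^ k * n ^ ?m"
        using mult_right_mono[OF binomial_fact_pow[of ?m k], of "n ^ ?m"] by (simp add: mult_ac)
      also have "\<dots> \<le> n ^ k * n ^ ?m" by (intro mult_right_mono power_mono) auto
      finally have "card {ys \<in> ?L. k \<le> count_list ys v} * fact k \<le> n ^ ?m"
        using t by (simp add: mult_ac)
      then have "real (card {ys \<in> ?L. k \<le> count_list ys v} * fact k) \<le> real (n ^ ?m)"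
        by (simp only: of_nat_le_iff)
      then show ?thesis by (simp add: field_simps)
    qed
    have "{ys \<in> ?L. \<exists>v\<in>S. k \<le> count_list ys v} = (\<Union>v\<in>S. {ys \<in> ?L. k \<le> count_list ys v})" by blast
    then have "card {ys \<in> ?L. \<exists>v\<in>S. k \<le> count_list ys v} \<le> (\<Sum>v\<in>S. card {ys \<in> ?L. k \<le> count_list ys v})"
      using card_UN_le[OF finS, of "\<lambda>v. {ys \<in> ?L. k \<le> count_list ys v}"] by simp
    then have "real (card {ys \<in> ?L. \<exists>v\<in>S. k \<le> count_list ys v})
        \<le> (\<Sum>v\<in>S. real (card {ys \<in> ?L. k \<le> count_list ys v}))"
      unfolding of_nat_sum[symmetric] by (simp only: of_nat_le_iff)
    also have "\<dots> \<le> (\<Sum>v\<in>S. real n ^ ?m / fact k)" by (intro sum_mono each)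
    finally show ?thesis using t by (simp add: field_simps)
  qed
  finally show ?thesis .
qed

text \<open>A non-root with \<open>k\<close> occurrences has degree \<open>k + 1\<close>, so under
  the event there is none; \<open>e\<close> is the expected number of such non-roots. A root with
  \<open>k\<close> occurrences before the last letter may have degree only \<open>k\<close>, hence
  the restriction to non-roots.\<close>

lemma prob_random_forest_degrees_le:
  fixes e :: real
  assumes t: "1 \<le> t" "t < n" and n: "n \<ge> 3" and k: "k \<le> n - t - 1"
    and e: "e = real (n - t) * ((n - t - 1 choose k) * (real n - 1) ^ (n - t - 1 - k)) / real n ^ (n - t - 1)"
  shows "measure_pmf.prob (random_forest n t) {F. \<forall>v\<in>{1..n}. vertex_degree F v \<le> k}
    \<le> 1 / e + ((real n - 1) / (real n - 2)) ^ (2 * k) - 1"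
proof -
  have "measure_pmf.prob (random_forest n t) {F. \<forall>v\<in>{1..n}. vertex_degree F v \<le> k} \<le>
    card {ys \<in> lists_of_length {1..n} (n - t - 1). \<forall>v\<in>{t<..n}. count_list ys v \<noteq> k} / real n ^ (n - t - 1)"
  proof (rule prob_random_forest_le[OF t, where P = "\<lambda>d. \<forall>v\<in>{1..n}. d v \<le> k"])
    fix ys r assume r: "r \<in> {1..t}" and le: "\<forall>v\<in>{1..n}. code_degree {1..n} {1..t} (ys @ [r]) v \<le> k"
    show "\<forall>v\<in>{t<..n}. count_list ys v \<noteq> k"
    proof
      fix v assume v: "v \<in> {t<..n}"
      then have "code_degree {1..n} {1..t} (ys @ [r]) v \<le> k" using le by auto
      then show "count_list ys v \<noteq> k" using v r by (auto simp: code_degree_def)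
    qed
  qed
  also have "\<dots> \<le> 1 / e + ((real n - 1) / (real n - 2)) ^ (2 * k) - 1"
  proof -
    have "{t<..n} \<subseteq> {1..n}" "{t<..n} \<noteq> {}" using t by auto
    then show ?thesis
      using card_no_count_list_eq_le[of "{1..n}" "{t<..n}" k "n - t - 1" e] n k e by simp
  qed
  finally show ?thesis .
qed

section \<open>Stirling bounds and the function mu\<close>

text \<open>The decrement \<open>a k - a (Suc k)\<close> is
  \<open>(k + 1/2) * ln (1 + 1/k) - 1\<close>. Bounding the integral of \<open>1/x\<close> over
  \<open>[k, k + 1]\<close> below by its midpoint value makes it nonnegative; the trapezoidal rule
  from above leaves the excess \<open>1/(4*k) - 1/(4*(k+1))\<close>, which telescopes.\<close>

lemma ln_fact_Suc_bounds:
  fixes a :: "nat \<Rightarrow> real"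
  defines "a \<equiv> \<lambda>k. ln (fact k) - ((real k + 1/2) * ln (real k) - real k)"
  assumes "k \<ge> 1"
  shows "a (Suc k) \<le> a k" "a k - 1 / (4 * real k) \<le> a (Suc k) - 1 / (4 * real (Suc k))"
proof -
  define x where "x = real k"
  have x: "x \<ge> 1" using assms by (simp add: x_def)
  define l where "l = ln (x + 1) - ln x"
  have "ln (fact (Suc k) :: real) = ln (x + 1) + ln (fact k)"
    unfolding fact_Suc using x by (subst ln_mult) (simp_all add: x_def add.commute)
  then have d: "a k - a (Suc k) = (x + 1/2) * l - 1"
    by (simp add: a_def x_def l_def algebra_simps)
  have "l \<ge> 2 * (x + 1 - x) / (x + (x + 1))"
    unfolding l_def using x by (intro ln_inverse_approx_ge) auto
  then have "l * (x + 1/2) \<ge> 1" using x by (simp add: field_simps)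
  then show "a (Suc k) \<le> a k" using d by (simp add: mult.commute)
  have "l \<le> 1 * (inverse x + inverse (x + 1)) / 2"
    unfolding l_def using x by (intro ln_inverse_approx_le) auto
  then have "(x + 1/2) * l \<le> (x + 1/2) * ((inverse x + inverse (x + 1)) / 2)"
    using x by (intro mult_left_mono) auto
  also have "\<dots> = 1 + 1 / (4 * x) - 1 / (4 * (x + 1))"
    using x by (simp add: divide_simps) (simp add: algebra_simps)
  finally show "a k - 1 / (4 * real k) \<le> a (Suc k) - 1 / (4 * real (Suc k))"
    using d by (simp add: x_def add.commute)
qed

text \<open>The constant \<open>ln (sqrt (2 * pi))\<close> of Stirling's formula is left out, so
  that the equation defining \<open>mu n\<close> becomes
  \<open>stirling_exponent (mu n) = ln (real n)\<close>.\<close>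

definition stirling_exponent :: "real \<Rightarrow> real" where
  "stirling_exponent y = (y + 1/2) * ln y - y"

lemma ln_fact_bounds:
  assumes "k \<ge> 1"
  shows "stirling_exponent k \<le> ln (fact k)" "ln (fact k) \<le> stirling_exponent k + 1"
proof -
  \<comment> \<open>At \<open>k = 1\<close> the difference is \<open>1\<close>. It does not increase
    from there, while the difference minus \<open>1 / (4 * k)\<close> starts at \<open>3/4\<close>
    and does not decrease.\<close>
  have "ln (fact k) - stirling_exponent k \<le> 1 \<and> 3/4 \<le> ln (fact k) - stirling_exponent k - 1 / (4 * real k)"
    using assms
  proof (induction k rule: nat_induct_at_least)
    case base
    then show ?case by (simp add: stirling_exponent_def)
  next
    case (Suc k)
    then show ?case using ln_fact_Suc_bounds[of k] unfolding stirling_exponent_def by linarith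
  qed
  moreover have "1 / (4 * real k) \<ge> 0" by simp
  ultimately show "stirling_exponent k \<le> ln (fact k)" "ln (fact k) \<le> stirling_exponent k + 1"
    by linarith+
qed

text \<open>Mean value theorem: the derivative \<open>ln z + 1 / (2 * z)\<close> lies between
  \<open>ln x\<close> and \<open>ln y + 1\<close>. This measures how fast \<open>n / fact k\<close>
  changes as \<open>k\<close> moves away from \<open>mu n\<close>.\<close>

lemma stirling_exponent_diff:
  assumes "1 \<le> x" "x \<le> y"
  shows "(y - x) * ln x \<le> stirling_exponent y - stirling_exponent x"
    "stirling_exponent y - stirling_exponent x \<le> (y - x) * (ln y + 1)"
proof -
  have D: "(stirling_exponent has_real_derivative (ln z + 1 / (2 * z))) (at z)" if "z > 0" for z
    unfolding stirling_exponent_def[abs_def] using that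
    by (auto intro!: derivative_eq_intros simp: field_simps)
  have "(y - x) * ln x \<le> stirling_exponent y - stirling_exponent x \<and>
    stirling_exponent y - stirling_exponent x \<le> (y - x) * (ln y + 1)"
  proof (cases "x = y")
    case False
    then have "\<exists>z>x. z < y \<and> stirling_exponent y - stirling_exponent x = (y - x) * (ln z + 1 / (2 * z))"
      using assms by (intro MVT2 D) auto
    then obtain z where z: "x < z" "z < y"
      "stirling_exponent y - stirling_exponent x = (y - x) * (ln z + 1 / (2 * z))" by blast
    have "ln x \<le> ln z + 1 / (2 * z)" using z assms by (intro add_increasing2) auto
    moreover have "ln z + 1 / (2 * z) \<le> ln y + 1" using z assms by (intro add_mono) (auto simp: field_simps)
    ultimately show ?thesis using assms unfolding z(3) by (auto intro!: mult_left_mono)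
  qed simp
  then show "(y - x) * ln x \<le> stirling_exponent y - stirling_exponent x"
    "stirling_exponent y - stirling_exponent x \<le> (y - x) * (ln y + 1)" by auto
qed

lemma mu_eq:
  assumes "n \<ge> 1"
  shows "mu n > 0" "stirling_exponent (mu n) = ln (real n)"
  using theI'[OF mu_ex1[OF assms]] unfolding mu_def[symmetric] stirling_exponent_def by auto

text \<open>The defining equation gives \<open>(mu n + 1/2) * ln (mu n) > ln (real n)\<close>, and
  the left side would stay bounded above along with \<open>mu n\<close>.\<close>

lemma filterlim_mu: "filterlim mu at_top sequentially"
  unfolding filterlim_at_top_ge[of _ _ 1]
proof (intro allI impI)
  fix M :: real assume M: "M \<ge> 1"
  have "filterlim (\<lambda>n. ln (real n)) at_top sequentially"
    by (rule filterlim_compose[OF ln_at_top filterlim_real_sequentially])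
  then have "eventually (\<lambda>n. ln (real n) > (M + 1/2) * ln M) sequentially"
    by (simp add: filterlim_at_top_dense)
  then show "eventually (\<lambda>n. M \<le> mu n) sequentially"
    using eventually_ge_at_top[of 1]
  proof eventually_elim
    case (elim n)
    note m = mu_eq[OF elim(2)]
    show "M \<le> mu n"
    proof (rule ccontr)
      assume "\<not> M \<le> mu n"
      then have less: "mu n < M" by simp
      have "(mu n + 1/2) * ln (mu n) \<le> (M + 1/2) * ln M"
      proof (cases "mu n \<ge> 1")
        case True
        then show ?thesis using less by (intro mult_mono) auto
      next
        case False
        then have "(mu n + 1/2) * ln (mu n) \<le> 0" using m(1) by (intro mult_nonneg_nonpos) auto
        also have "0 \<le> (M + 1/2) * ln M" using M by simp
        finally show ?thesis .
      qed
      then show False using m elim(1) by (simp add: stirling_exponent_def)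
    qed
  qed
qed

lemma eventually_mu_ge: "eventually (\<lambda>n. mu n \<ge> c) sequentially"
  using filterlim_mu by (simp add: filterlim_at_top)

text \<open>From \<open>mu n \<ge> exp 2\<close> on, \<open>ln (mu n)\<close> is at least
  \<open>2\<close>, hence \<open>stirling_exponent (mu n)\<close> is at least
  \<open>2 * mu n - mu n\<close>.\<close>

lemma eventually_mu_le_ln: "eventually (\<lambda>n. mu n \<le> ln (real n)) sequentially"
  using eventually_mu_ge[of "exp 2"] eventually_ge_at_top[of 1]
proof eventually_elim
  case (elim n)
  have "2 \<le> ln (mu n)" using elim(1) mu_eq(1)[OF elim(2)] ln_ge_iff by blast
  then have "mu n * 2 \<le> (mu n + 1/2) * ln (mu n)" using mu_eq(1)[OF elim(2)] by (intro mult_mono) auto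
  then show ?case using mu_eq(2)[OF elim(2)] by (simp add: stirling_exponent_def)
qed

section \<open>Asymptotics\<close>

lemma with_high_probabilityI:
  assumes le: "eventually (\<lambda>n. measure_pmf.prob (p n) {x. \<not> P n x} \<le> f n) sequentially"
    and lim: "f \<longlonglongrightarrow> 0"
  shows "with_high_probability p P"
proof -
  have eq: "measure_pmf.prob (p n) {x. P n x} = 1 - measure_pmf.prob (p n) {x. \<not> P n x}" for n
    using measure_pmf.prob_compl[of "{x. \<not> P n x}" "p n"] by (simp add: Compl_eq_Diff_UNIV[symmetric] Collect_neg_eq)
  have "(\<lambda>n. measure_pmf.prob (p n) {x. \<not> P n x}) \<longlonglongrightarrow> 0"
    by (rule tendsto_sandwich[OF _ le tendsto_const lim]) simp
  then show ?thesis
    unfolding with_high_probability_def eq by (auto intro!: tendsto_eq_intros)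
qed

lemma with_high_probability_conj:
  assumes "with_high_probability p P" "with_high_probability p Q"
  shows "with_high_probability p (\<lambda>n x. P n x \<and> Q n x)"
proof (rule with_high_probabilityI)
  let ?f = "\<lambda>R n. 1 - measure_pmf.prob (p n) {x. R n x}"
  have eq: "measure_pmf.prob (p n) {x. \<not> R n x} = ?f R n" for R n
    using measure_pmf.prob_compl[of "{x. R n x}" "p n"] by (simp add: Compl_eq_Diff_UNIV[symmetric] Collect_neg_eq)
  have "measure_pmf.prob (p n) {x. \<not> (P n x \<and> Q n x)} \<le> ?f P n + ?f Q n" for n
  proof -
    have "{x. \<not> (P n x \<and> Q n x)} = {x. \<not> P n x} \<union> {x. \<not> Q n x}" by blast
    then show ?thesis using measure_Un_le[of "{x. \<not> P n x}" "measure_pmf (p n)" "{x. \<not> Q n x}"] by (simp add: eq)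
  qed
  then show "eventually (\<lambda>n. measure_pmf.prob (p n) {x. \<not> (P n x \<and> Q n x)} \<le> ?f P n + ?f Q n) sequentially"
    by simp
  show "(\<lambda>n. ?f P n + ?f Q n) \<longlonglongrightarrow> 0"
    using assms unfolding with_high_probability_def by (auto intro!: tendsto_eq_intros)
qed

lemma with_high_probability_mono:
  assumes "with_high_probability p P" "eventually (\<lambda>n. \<forall>x. P n x \<longrightarrow> Q n x) sequentially"
  shows "with_high_probability p Q"
proof (rule with_high_probabilityI)
  show "eventually (\<lambda>n. measure_pmf.prob (p n) {x. \<not> Q n x} \<le> 1 - measure_pmf.prob (p n) {x. P n x}) sequentially"
    using assms(2)
  proof eventually_elim
    case (elim n)
    have "measure_pmf.prob (p n) {x. \<not> Q n x} \<le> measure_pmf.prob (p n) (UNIV - {x. P n x})"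
      using elim by (intro measure_pmf.finite_measure_mono) auto
    then show ?case using measure_pmf.prob_compl[of "{x. P n x}" "p n"] by simp
  qed
  show "(\<lambda>n. 1 - measure_pmf.prob (p n) {x. P n x}) \<longlonglongrightarrow> 0"
    using assms(1) unfolding with_high_probability_def by (auto intro!: tendsto_eq_intros)
qed

lemma tendsto_exp_neg_ln:
  fixes \<delta> c :: real
  assumes "\<delta> > 0" "filterlim f at_top sequentially"
  shows "(\<lambda>n. exp (c - \<delta> * ln (f n))) \<longlonglongrightarrow> 0"
proof -
  have "((\<lambda>x::real. exp (c - \<delta> * ln x)) \<longlongrightarrow> 0) at_top" using assms(1) by real_asymp
  then show ?thesis by (rule filterlim_compose[OF _ assms(2)])
qed

text \<open>The union bound is \<open>n / fact k\<close>; since \<open>k\<close> exceeds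
  \<open>mu n\<close> by at least \<delta>, it is at most \<open>mu n\<close> to the power
  \<open>- \<delta>\<close>.\<close>

lemma whp_degree_le:
  assumes t: "\<And>n. n \<ge> 2 \<Longrightarrow> 1 \<le> t n \<and> t n < n" and "\<delta> > 0"
    and k: "eventually (\<lambda>n. mu n + \<delta> \<le> real (k n)) sequentially"
  shows "with_high_probability (\<lambda>n. random_forest n (t n)) (\<lambda>n F. \<forall>v\<in>{1..n}. vertex_degree F v \<le> k n)"
proof (rule with_high_probabilityI)
  show "(\<lambda>n. exp (0 - \<delta> * ln (mu n))) \<longlonglongrightarrow> 0"
    by (rule tendsto_exp_neg_ln[OF \<open>\<delta> > 0\<close> filterlim_mu])
  show "\<forall>\<^sub>F n in sequentially. measure_pmf.prob (random_forest n (t n))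
      {F. \<not> (\<forall>v\<in>{1..n}. vertex_degree F v \<le> k n)} \<le> exp (0 - \<delta> * ln (mu n))"
    using k eventually_mu_ge[of 1] eventually_ge_at_top[of 2]
  proof eventually_elim
    case (elim n)
    have n: "n \<ge> 1" using elim by simp
    have "real (k n) \<ge> 1" using elim \<open>\<delta> > 0\<close> by linarith
    then have k1: "k n \<ge> 1" by linarith
    have "\<delta> * ln (mu n) \<le> (real (k n) - mu n) * ln (mu n)"
      using elim by (intro mult_right_mono) auto
    also have "\<dots> \<le> stirling_exponent (k n) - stirling_exponent (mu n)"
      using elim \<open>\<delta> > 0\<close> by (intro stirling_exponent_diff) auto
    also have "\<dots> \<le> ln (fact (k n)) - ln (real n)"
      using ln_fact_bounds[OF k1] mu_eq[OF n] by simp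
    finally have *: "ln (real n) - ln (fact (k n)) \<le> 0 - \<delta> * ln (mu n)" by simp
    have "{F. \<not> (\<forall>v\<in>{1..n}. vertex_degree F v \<le> k n)} = {F. \<exists>v\<in>{1..n}. k n < vertex_degree F v}"
      by (auto simp: not_le)
    then have "measure_pmf.prob (random_forest n (t n)) {F. \<not> (\<forall>v\<in>{1..n}. vertex_degree F v \<le> k n)}
        \<le> real n / fact (k n)"
      using prob_random_forest_degree_gt[of "t n" n "{1..n}" "k n"] t[of n] elim(3) by simp
    also have "\<dots> = exp (ln (real n) - ln (fact (k n)))" using n by (simp add: exp_diff)
    also have "\<dots> \<le> exp (0 - \<delta> * ln (mu n))" using * by simp
    finally show ?case .
  qed
qed

text \<open>The union bound is \<open>(t / n) * (n / fact k)\<close>. The second factor is only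
  polylogarithmic in \<open>n\<close>, and \<open>n powr (- \<beta>)\<close> beats it.\<close>

lemma whp_root_degree_le:
  fixes c :: real
  assumes t: "\<And>n. n \<ge> 2 \<Longrightarrow> 1 \<le> t n \<and> t n < n"
    and \<beta>: "\<beta> > 0" and C: "eventually (\<lambda>n. real (t n) \<le> C * real n powr (- \<beta>) * real n) sequentially" "C > 0"
    and c: "c \<ge> 0"
  shows "with_high_probability (\<lambda>n. random_forest n (t n))
    (\<lambda>n F. \<forall>v\<in>{1..t n}. vertex_degree F v \<le> nat \<lfloor>mu n - c\<rfloor>)"
proof (rule with_high_probabilityI)
  \<comment> \<open>Rounding down leaves \<open>k\<close> at most \<open>c + 1\<close> below
    \<open>mu n\<close>, and \<open>stirling_exponent\<close> rises over that gap with average slope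
    at most \<open>ln (mu n) + 1 \<le> ln (ln n) + 1\<close>.\<close>
  define g where "g n = C * real n powr (- \<beta>) * exp ((c + 1) * (ln (ln (real n)) + 1))" for n
  show "g \<longlonglongrightarrow> 0" unfolding g_def using \<beta> c C(2) by real_asymp
  show "\<forall>\<^sub>F n in sequentially. measure_pmf.prob (random_forest n (t n))
      {F. \<not> (\<forall>v\<in>{1..t n}. vertex_degree F v \<le> nat \<lfloor>mu n - c\<rfloor>)} \<le> g n"
    using C(1) eventually_mu_ge[of "c + 2"] eventually_ge_at_top[of 2] eventually_mu_le_ln
  proof eventually_elim
    case (elim n)
    have n: "n \<ge> 1" using elim by simp
    define k where "k = nat \<lfloor>mu n - c\<rfloor>"
    have kk: "real k \<le> mu n - c" "mu n - c - 1 \<le> real k" using elim unfolding k_def by linarith+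
    then have k1: "k \<ge> 1" using elim by linarith
    have "ln (real n) - ln (fact k) \<le> stirling_exponent (mu n) - stirling_exponent k"
      using ln_fact_bounds[OF k1] mu_eq[OF n] by simp
    also have "\<dots> \<le> (mu n - k) * (ln (mu n) + 1)"
      using k1 kk c by (intro stirling_exponent_diff) auto
    also have "\<dots> \<le> (c + 1) * (ln (ln (real n)) + 1)"
      using kk elim c by (intro mult_mono add_mono) (auto simp: ln_ge_zero)
    finally have *: "ln (real n) - ln (fact k) \<le> (c + 1) * (ln (ln (real n)) + 1)" .
    have "{F. \<not> (\<forall>v\<in>{1..t n}. vertex_degree F v \<le> k)} = {F. \<exists>v\<in>{1..t n}. k < vertex_degree F v}"
      by (auto simp: not_le)
    then have "measure_pmf.prob (random_forest n (t n)) {F. \<not> (\<forall>v\<in>{1..t n}. vertex_degree F v \<le> k)}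
        \<le> real (t n) / fact k"
      using prob_random_forest_degree_gt[of "t n" n "{1..t n}" k] t[of n] elim(3) by auto
    also have "\<dots> = real (t n) / real n * exp (ln (real n) - ln (fact k))" using n by (simp add: exp_diff)
    also have "\<dots> \<le> g n"
      unfolding g_def using elim(1) * n C(2) by (intro mult_mono) (auto simp: field_simps)
    finally show ?case by (simp add: k_def)
  qed
qed

section \<open>Lower bound for the maximum degree\<close>

lemma power_mult_fact_le: "a ^ k * fact a \<le> (fact (a + k) :: nat)"
proof (induction k)
  case (Suc k)
  have "a ^ Suc k * fact a = a * (a ^ k * fact a)" by simp
  also have "\<dots> \<le> (a + Suc k) * fact (a + k)" using Suc by (intro mult_le_mono) auto
  finally show ?case by simp
qed simp

lemma power_le_binomial_mult_fact:
  assumes "k \<le> m"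
  shows "(m - k) ^ k \<le> (m choose k) * fact k"
proof -
  have "(m - k) ^ k * fact (m - k) \<le> fact m" using power_mult_fact_le[of "m - k" k] assms by simp
  also have "\<dots> = (m choose k) * fact k * fact (m - k)"
    using binomial_fact_lemma[OF assms] by (simp add: mult_ac)
  finally show ?thesis by simp
qed

text \<open>With \<open>m = n - t - 1\<close>, the mean is \<open>n / fact k\<close> times three
  factors: \<open>(n - t) / n\<close>, at least \<open>1/2\<close>; the falling factorial of
  \<open>m\<close> over \<open>n ^ k\<close>, at least \<open>1/2\<close> by Bernoulli's inequality;
  and \<open>(1 - 1/n) ^ (m - k)\<close>, at least \<open>exp (-1) / 2\<close>. This gives the
  constant \<open>exp (-1) / 8\<close>.\<close>

lemma expected_vertices_of_degree_ge:
  assumes "1 \<le> t" "t < n" and small: "real k * (real t + 1 + real k) / real n \<le> 1/2"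
    and k: "k \<ge> 1" and t: "real t / real n \<le> 1/2" and r: "(1 + (-1) / real n) ^ n \<ge> exp (-1) / 2"
  shows "k \<le> n - t - 1"
    "exp (-1) / 8 * (real n / fact k) \<le>
       real (n - t) * ((n - t - 1 choose k) * (real n - 1) ^ (n - t - 1 - k)) / real n ^ (n - t - 1)"
proof -
  have n: "n \<ge> 2" using assms(1,2) by simp
  define m where "m = n - t - 1"
  have s: "real k * (real t + 1 + real k) \<le> real n / 2" using small n by (simp add: field_simps)
  have "1 * (real t + 1 + real k) \<le> real k * (real t + 1 + real k)"
    using k by (intro mult_right_mono) auto
  also note s
  finally have s': "real t + 1 + real k \<le> real n / 2" by simp
  then show km: "k \<le> n - t - 1" by linarith
  have rm: "real (m - k) = real n - real t - 1 - real k"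
    using km assms unfolding m_def by (simp add: of_nat_diff)
  have "1/2 \<le> 1 + real k * (- (real t + 1 + real k) / real n)"
    using small by (simp only: times_divide_eq_right mult_minus_right minus_divide_left[symmetric])
  also have "\<dots> \<le> (1 + - (real t + 1 + real k) / real n) ^ k"
    using s' n by (intro Bernoulli_inequality) (simp add: field_simps)
  also have "1 + - (real t + 1 + real k) / real n = real (m - k) / real n"
    using n by (simp add: rm field_simps)
  finally have A: "1/2 \<le> (real (m - k) / real n) ^ k" .
  have B: "exp (-1) / 2 \<le> ((real n - 1) / real n) ^ (m - k)"
  proof -
    have "exp (-1) / 2 \<le> ((real n - 1) / real n) ^ n" using r n by (simp add: field_simps)
    also have "\<dots> \<le> ((real n - 1) / real n) ^ (m - k)"
      using n by (intro power_decreasing) (auto simp: m_def)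
    finally show ?thesis .
  qed
  have D: "1/2 \<le> real (n - t) / real n" using t n assms by (simp add: field_simps of_nat_diff)
  have "(m - k) ^ k \<le> (m choose k) * fact k"
    using km unfolding m_def by (rule power_le_binomial_mult_fact)
  then have "real ((m - k) ^ k) \<le> real ((m choose k) * fact k)" by (simp only: of_nat_le_iff)
  then have E: "real (m - k) ^ k / fact k \<le> real (m choose k)" by (simp add: field_simps)
  have "exp (-1) / 8 * (real n / fact k) = 1/2 * (1/2 * (exp (-1) / 2)) * (real n / fact k)" by simp
  also have "\<dots> \<le> real (n - t) / real n * ((real (m - k) / real n) ^ k * ((real n - 1) / real n) ^ (m - k)) * (real n / fact k)"
    using A B D n by (intro mult_right_mono mult_mono) auto
  also have "\<dots> = real (n - t) * (real (m - k) ^ k / fact k * (real n - 1) ^ (m - k)) / real n ^ m"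
  proof -
    have "real n ^ m = real n ^ k * real n ^ (m - k)"
      using km by (simp only: m_def power_add[symmetric] le_add_diff_inverse)
    then show ?thesis using n by (simp add: power_divide field_simps)
  qed
  also have "\<dots> \<le> real (n - t) * (real (m choose k) * (real n - 1) ^ (m - k)) / real n ^ m"
    using E n by (intro divide_right_mono mult_left_mono mult_right_mono) auto
  finally show "exp (-1) / 8 * (real n / fact k) \<le>
       real (n - t) * ((n - t - 1 choose k) * (real n - 1) ^ (n - t - 1 - k)) / real n ^ (n - t - 1)"
    by (simp add: m_def)
qed

lemma whp_exists_degree_gt:
  assumes t: "\<And>n. n \<ge> 2 \<Longrightarrow> 1 \<le> t n \<and> t n < n" and \<epsilon>: "\<epsilon> > 0"
    and \<beta>: "\<beta> > 0" and C: "eventually (\<lambda>n. real (t n) \<le> C * real n powr (- \<beta>) * real n) sequentially" "C > 0"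
  shows "with_high_probability (\<lambda>n. random_forest n (t n))
    (\<lambda>n F. \<exists>v\<in>{1..n}. nat \<lfloor>mu n - \<epsilon>\<rfloor> < vertex_degree F v)"
proof (rule with_high_probabilityI)
  define k where "k n = nat \<lfloor>mu n - \<epsilon>\<rfloor>" for n
  \<comment> \<open>The first summand bounds \<open>1 / e\<close>, with \<open>8 * exp 1\<close>
    from the lower bound on the mean and the inner \<open>1\<close> from the upper Stirling bound;
    the second bounds the pair term, using \<open>k \<le> ln n\<close>.\<close>
  define f where "f n = 8 * exp 1 * exp (1 - \<epsilon> * ln (real (k n))) + (exp (2 * ln (real n) / (real n - 2)) - 1)" for n
  have k_lim: "filterlim (\<lambda>n. real (k n)) at_top sequentially"
  proof (rule filterlim_at_top_mono)
    show "filterlim (\<lambda>n. - \<epsilon> - 1 + mu n) at_top sequentially"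
      by (rule filterlim_tendsto_add_at_top[OF tendsto_const filterlim_mu])
    show "eventually (\<lambda>n. - \<epsilon> - 1 + mu n \<le> real (k n)) sequentially"
      unfolding k_def by (rule always_eventually) linarith
  qed
  have "(\<lambda>n. exp (2 * ln (real n) / (real n - 2)) - 1) \<longlonglongrightarrow> 0" by real_asymp
  from tendsto_add[OF tendsto_mult_right_zero[OF tendsto_exp_neg_ln[OF \<epsilon> k_lim, of 1], of "8 * exp 1"] this]
  show "f \<longlonglongrightarrow> 0" unfolding f_def by simp
  \<comment> \<open>\<open>h\<close> dominates \<open>k * (t + 1 + k) / n\<close>, the quantity that
    Bernoulli's inequality needs small, once \<open>k \<le> ln n\<close> and the bound on
    \<open>t\<close> are inserted.\<close>
  define h where "h n = C * (ln (real n) * real n powr (- \<beta>)) + ln (real n) * (1 + ln (real n)) / real n" for n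
  have "(\<lambda>n. C * (ln (real n) * real n powr (- \<beta>))) \<longlonglongrightarrow> 0" using \<beta> by real_asymp
  moreover have "(\<lambda>n. ln (real n) * (1 + ln (real n)) / real n) \<longlonglongrightarrow> 0" by real_asymp
  ultimately have l1: "h \<longlonglongrightarrow> 0" unfolding h_def by (rule tendsto_add_zero)
  have l2: "(\<lambda>n. C * real n powr (- \<beta>)) \<longlonglongrightarrow> 0"
    using \<beta> C(2) by real_asymp
  have "(\<lambda>n. (1 + (-1) / real n) ^ n) \<longlonglongrightarrow> exp (-1)" by (rule tendsto_exp_limit_sequentially)
  then have ev3: "eventually (\<lambda>n. (1 + (-1) / real n) ^ n > exp (-1) / 2) sequentially"
    by (rule order_tendstoD) simp
  have ev1: "eventually (\<lambda>n. h n < 1/2) sequentially"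
    by (rule order_tendstoD(2)[OF l1]) simp
  have ev2: "eventually (\<lambda>n. C * real n powr (- \<beta>) < 1/2) sequentially"
    by (rule order_tendstoD(2)[OF l2]) simp
  show "\<forall>\<^sub>F n in sequentially. measure_pmf.prob (random_forest n (t n))
      {F. \<not> (\<exists>v\<in>{1..n}. nat \<lfloor>mu n - \<epsilon>\<rfloor> < vertex_degree F v)} \<le> f n"
    using C(1) ev1 ev2 ev3 eventually_mu_ge[of "\<epsilon> + 1"] eventually_mu_le_ln eventually_ge_at_top[of 3]
  proof eventually_elim
    case (elim n)
    have n: "n \<ge> 1" "n \<ge> 3" and tn: "1 \<le> t n" "t n < n" using elim(7) t[of n] by auto
    have km: "real (k n) \<le> mu n - \<epsilon>" and k1: "k n \<ge> 1"
      using elim(5) unfolding k_def by linarith+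
    have kln: "real (k n) \<le> ln (real n)" using km elim(6) \<epsilon> by linarith
    have "real (k n) * (real (t n) + 1 + real (k n)) / real n
        \<le> ln (real n) * (C * real n powr (- \<beta>) * real n + 1 + ln (real n)) / real n"
      using kln elim(1) by (intro divide_right_mono mult_mono add_mono) auto
    also have "\<dots> = h n" unfolding h_def using n by (simp add: field_simps)
    finally have small: "real (k n) * (real (t n) + 1 + real (k n)) / real n \<le> 1/2" using elim(2) by linarith
    have "real (t n) / real n \<le> C * real n powr (- \<beta>)"
      using elim(1) n by (simp add: field_simps)
    then have t2: "real (t n) / real n \<le> 1/2" using elim(3) by linarith
    define e where "e = real (n - t n) * ((n - t n - 1 choose k n) * (real n - 1) ^ (n - t n - 1 - k n)) / real n ^ (n - t n - 1)"
    note ex = expected_vertices_of_degree_ge[OF tn small k1 t2 less_imp_le[OF elim(4)], folded e_def]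
    have "\<epsilon> * ln (real (k n)) \<le> (mu n - real (k n)) * ln (real (k n))"
      using km k1 by (intro mult_right_mono) auto
    also have "\<dots> \<le> stirling_exponent (mu n) - stirling_exponent (k n)"
      using km k1 \<epsilon> by (intro stirling_exponent_diff) auto
    also have "\<dots> \<le> ln (real n) - (ln (fact (k n)) - 1)"
      using ln_fact_bounds[OF k1] mu_eq[OF n(1)] by simp
    finally have *: "ln (fact (k n)) - ln (real n) \<le> 1 - \<epsilon> * ln (real (k n))" by simp
    have "1 / e \<le> 1 / (exp (-1) / 8 * (real n / fact (k n)))"
      using ex(2) n by (intro divide_left_mono mult_pos_pos order.strict_trans2[OF _ ex(2)]) auto
    also have "\<dots> = 8 * exp 1 * exp (ln (fact (k n)) - ln (real n))"
      using n by (simp add: exp_diff exp_minus field_simps)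
    also have "\<dots> \<le> 8 * exp 1 * exp (1 - \<epsilon> * ln (real (k n)))"
      using * by (intro mult_left_mono) auto
    finally have e1: "1 / e \<le> 8 * exp 1 * exp (1 - \<epsilon> * ln (real (k n)))" .
    have e2: "((real n - 1) / (real n - 2)) ^ (2 * k n) \<le> exp (2 * ln (real n) / (real n - 2))"
    proof -
      have "(real n - 1) / (real n - 2) = 1 + 1 / (real n - 2)" using n by (simp add: field_simps)
      also have "\<dots> \<le> exp (1 / (real n - 2))" by (rule exp_ge_add_one_self)
      finally have "((real n - 1) / (real n - 2)) ^ (2 * k n) \<le> exp (1 / (real n - 2)) ^ (2 * k n)"
        using n by (intro power_mono) auto
      also have "\<dots> = exp (2 * real (k n) / (real n - 2))"
        by (simp add: exp_of_nat_mult[symmetric])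
      also have "\<dots> \<le> exp (2 * ln (real n) / (real n - 2))"
        using kln n by (auto intro!: divide_right_mono)
      finally show ?thesis .
    qed
    have "{F. \<not> (\<exists>v\<in>{1..n}. k n < vertex_degree F v)} = {F. \<forall>v\<in>{1..n}. vertex_degree F v \<le> k n}"
      by (auto simp: not_less)
    then have "measure_pmf.prob (random_forest n (t n)) {F. \<not> (\<exists>v\<in>{1..n}. k n < vertex_degree F v)}
        \<le> 1 / e + ((real n - 1) / (real n - 2)) ^ (2 * k n) - 1"
      using prob_random_forest_degrees_le[OF tn n(2) ex(1) e_def] by simp
    also have "\<dots> \<le> f n" using e1 e2 unfolding f_def by linarith
    finally show ?case by (simp add: k_def)
  qed
qed

section \<open>From vertex degrees to the maximum degree\<close>

lemma max_degree_le_iff: "(n::nat) \<ge> 1 \<Longrightarrow> max_degree {1..n} F \<le> k \<longleftrightarrow> (\<forall>v\<in>{1..n}. vertex_degree F v \<le> k)"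
  unfolding max_degree_def by (subst Max_le_iff) auto

lemma vertex_degree_le_max_degree: "v \<in> {1..n::nat} \<Longrightarrow> vertex_degree F v \<le> max_degree {1..n} F"
  unfolding max_degree_def by (intro Max_ge) auto

theorem theorem6p3:
  fixes t :: "nat \<Rightarrow> nat" and \<epsilon> :: real
  assumes t: "\<And>n. n \<ge> 2 \<Longrightarrow> 1 \<le> t n \<and> t n < n"
    and eps: "\<epsilon> > 0"
  shows "with_high_probability (\<lambda>n. random_forest n (t n))
           (\<lambda>n F. int (max_degree {1..n} F) \<le> \<lfloor>mu n\<rfloor> + 2) \<and>
         ((\<exists>\<beta>>0. (\<lambda>n. real (t n)) \<in> O(\<lambda>n. real n powr (1 - \<beta>))) \<longrightarrow>
           with_high_probability (\<lambda>n. random_forest n (t n))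
             (\<lambda>n F. \<lfloor>mu n - \<epsilon>\<rfloor> + 1 \<le> int (max_degree {1..n} F) \<and>
                    int (max_degree {1..n} F) \<le> \<lfloor>mu n + \<epsilon>\<rfloor> + 1) \<and>
           (\<forall>K::real. with_high_probability (\<lambda>n. random_forest n (t n))
             (\<lambda>n F. real (max_degree {1..n} F) - real (Max (vertex_degree F ` {1..t n})) \<ge> K)))"
proof (intro conjI impI allI)
  \<comment> \<open>Taking \<open>c = \<epsilon>\<close> yields the upper bound of the second claim,
    and \<open>c = 1\<close> the first claim because
    \<open>\<lfloor>mu n + 1\<rfloor> + 1 = \<lfloor>mu n\<rfloor> + 2\<close>.\<close>
  have upper: "with_high_probability (\<lambda>n. random_forest n (t n))
      (\<lambda>n F. int (max_degree {1..n} F) \<le> \<lfloor>mu n + c\<rfloor> + 1)" if "c > 0" for c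
  proof (rule with_high_probability_mono[OF whp_degree_le[OF t that, where k = "\<lambda>n. nat (\<lfloor>mu n + c\<rfloor> + 1)"]])
    show "eventually (\<lambda>n. mu n + c \<le> real (nat (\<lfloor>mu n + c\<rfloor> + 1))) sequentially"
      by (rule always_eventually) linarith
    show "\<forall>\<^sub>F n in sequentially. \<forall>F. (\<forall>v\<in>{1..n}. vertex_degree F v \<le> nat (\<lfloor>mu n + c\<rfloor> + 1)) \<longrightarrow>
        int (max_degree {1..n} F) \<le> \<lfloor>mu n + c\<rfloor> + 1"
      using eventually_ge_at_top[of 1] eventually_mu_ge[of 0]
    proof eventually_elim
      case (elim n)
      have "0 \<le> \<lfloor>mu n + c\<rfloor>" using elim that by simp
      then show ?case
        unfolding max_degree_le_iff[OF elim(1), symmetric] by (auto simp: le_nat_iff)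
    qed
  qed
  show "with_high_probability (\<lambda>n. random_forest n (t n)) (\<lambda>n F. int (max_degree {1..n} F) \<le> \<lfloor>mu n\<rfloor> + 2)"
    using upper[of 1] by (simp add: add.commute)
  assume "\<exists>\<beta>>0. (\<lambda>n. real (t n)) \<in> O(\<lambda>n. real n powr (1 - \<beta>))"
  then obtain \<beta> where \<beta>: "\<beta> > 0" "(\<lambda>n. real (t n)) \<in> O(\<lambda>n. real n powr (1 - \<beta>))" by blast
  then obtain C where C: "C > 0" "eventually (\<lambda>n. norm (real (t n)) \<le> C * norm (real n powr (1 - \<beta>))) sequentially"
    by (elim landau_o.bigE)
  have C': "eventually (\<lambda>n. real (t n) \<le> C * real n powr (- \<beta>) * real n) sequentially"
    using C(2) eventually_ge_at_top[of 1]
  proof eventually_elim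
    case (elim n)
    then have "real n powr (1 - \<beta>) = real n powr (- \<beta>) * real n"
      using powr_add[of "real n" "- \<beta>" 1] by (simp add: add.commute)
    then show ?case using elim by simp
  qed
  have lower: "with_high_probability (\<lambda>n. random_forest n (t n))
      (\<lambda>n F. \<lfloor>mu n - c\<rfloor> + 1 \<le> int (max_degree {1..n} F))" if "c > 0" for c
  proof (rule with_high_probability_mono[OF whp_exists_degree_gt[OF t that \<beta>(1) C' C(1)]])
    have "\<lfloor>mu n - c\<rfloor> + 1 \<le> int (max_degree {1..n} F)"
      if v: "v \<in> {1..n}" "nat \<lfloor>mu n - c\<rfloor> < vertex_degree F v" for n F v
      using v(2) vertex_degree_le_max_degree[OF v(1), of F] by linarith
    then show "\<forall>\<^sub>F n in sequentially. \<forall>F. (\<exists>v\<in>{1..n}. nat \<lfloor>mu n - c\<rfloor> < vertex_degree F v) \<longrightarrow>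
        \<lfloor>mu n - c\<rfloor> + 1 \<le> int (max_degree {1..n} F)"
      by (intro always_eventually) blast
  qed
  show "with_high_probability (\<lambda>n. random_forest n (t n))
      (\<lambda>n F. \<lfloor>mu n - \<epsilon>\<rfloor> + 1 \<le> int (max_degree {1..n} F) \<and> int (max_degree {1..n} F) \<le> \<lfloor>mu n + \<epsilon>\<rfloor> + 1)"
    by (rule with_high_probability_conj[OF lower[OF eps] upper[OF eps]])
  fix K :: real
  \<comment> \<open>The extra unit pays for the lower bound \<open>mu n - 1\<close> on the maximum
    degree: roots have degree at most \<open>mu n - c\<close>, which leaves a gap of at least
    \<open>c - 1 = \<bar>K\<bar>\<close>.\<close>
  define c where "c = 1 + \<bar>K\<bar>"
  have c: "c \<ge> 0" by (simp add: c_def)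
  show "with_high_probability (\<lambda>n. random_forest n (t n))
      (\<lambda>n F. real (max_degree {1..n} F) - real (Max (vertex_degree F ` {1..t n})) \<ge> K)"
  proof (rule with_high_probability_mono[OF with_high_probability_conj[OF lower[of 1]
          whp_root_degree_le[OF t \<beta>(1) C' C(1) c]]])
    show "\<forall>\<^sub>F n in sequentially. \<forall>F. \<lfloor>mu n - 1\<rfloor> + 1 \<le> int (max_degree {1..n} F) \<and>
          (\<forall>v\<in>{1..t n}. vertex_degree F v \<le> nat \<lfloor>mu n - c\<rfloor>) \<longrightarrow>
        K \<le> real (max_degree {1..n} F) - real (Max (vertex_degree F ` {1..t n}))"
      \<comment> \<open>The bound \<open>c \<le> mu n\<close> keeps \<open>nat\<close> from
        truncating a negative floor.\<close>
      using eventually_ge_at_top[of 2] eventually_mu_ge[of c]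
    proof (eventually_elim, intro allI impI, elim conjE)
      fix n F
      assume n: "n \<ge> 2" and mu: "c \<le> mu n" and lo: "\<lfloor>mu n - 1\<rfloor> + 1 \<le> int (max_degree {1..n} F)"
        and up: "\<forall>v\<in>{1..t n}. vertex_degree F v \<le> nat \<lfloor>mu n - c\<rfloor>"
      have "Max (vertex_degree F ` {1..t n}) \<le> nat \<lfloor>mu n - c\<rfloor>"
        using up t[OF n] by (subst Max_le_iff) auto
      then have "real (Max (vertex_degree F ` {1..t n})) \<le> mu n - c" using mu by linarith
      moreover have "mu n - 1 \<le> real (max_degree {1..n} F)" using lo by linarith
      ultimately show "K \<le> real (max_degree {1..n} F) - real (Max (vertex_degree F ` {1..t n}))"
        unfolding c_def by linarith
    qed
  qed simp
qed

end
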